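(* There is an algorithm which, given a sample $\mathcal{S}=(P,N)$ of concurrent game structures, decides in time polynomial in $|\mathcal{S}|$ whether there exists an (arbitrary) ATL formula consistent with $\mathcal{S}$.
   Context: A concurrent game structure (CGS) is a tuple $C=\langle Q,I,k,\mathcal{P},\pi,d,\delta\rangle$: $Q$ a finite set of states, $I\subseteq Q$ the initial states, $k\ge 1$ the number of agents with agent set $\mathsf{Ag}=\{1,\dots,k\}$, $\mathcal{P}$ a finite set of propositions, $\pi:Q\to 2^{\mathcal{P}}$ a labelling, $d:Q\times\mathsf{Ag}\to\mathbb{N}_{\ge1}$ giving the number of actions of each agent at each state, and $\delta$ mapping each tuple $(q,\alpha_1,\dots,\alpha_k)$ with $\alpha_a\in\{1,\dots,d(q,a)\}$ to a state. $Q_{\mathsf{Act}}(q)$ is the set of such tuples at $q$ and $Q_{\mathsf{Act}}=\bigcup_q Q_{\mathsf{Act}}(q)$. For $A\subseteq\mathsf{Ag}$, $\mathsf{Act}_A(q)$ is the set of tuples $(\alpha_a)_{a\in A}$ with $\alpha_a\in\{1,\dots,d(q,a)\}$, and for $\alpha\in\mathsf{Act}_A(q)$, $\mathsf{Succ}(q,\alpha)=\{\delta(q,(\alpha,\alpha')):\alpha'\in\mathsf{Act}_{\mathsf{Ag}\setminus A}(q)\}$. The size of $C$ is $|C|=|Q_{\mathsf{Act}}|+|\mathcal{P}|+|\mathsf{Ag}|$. A strategy for agent $a$ is a map $s_a:Q^+\to\mathbb{N}_{\ge1}$ with $s_a(\rho_0\cdots\rho_m)\le d(\rho_m,a)$;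 a strategy profile for $A$ is a tuple $s=(s_a)_{a\in A}$; $\mathsf{Out}(q,s)$ is the set of infinite sequences $\rho\in Q^\omega$ with $\rho[0]=q$ and $\rho[i+1]\in\mathsf{Succ}(\rho[i],(s_a(\rho[0]\cdots\rho[i]))_{a\in A})$ for all $i$. ATL state formulas: $\Phi::=p\mid\neg\Phi\mid\Phi\wedge\Phi\mid\langle\langle A\rangle\rangle\varphi$ with $p$ a proposition, $A\subseteq\mathsf{Ag}$, and path formulas $\varphi::=\mathbf{X}\Phi\mid\Phi\,\mathbf{U}\,\Phi\mid\mathbf{G}\Phi$. Semantics at a state $q$: $q\models p$ iff $p\in\pi(q)$; usual Boolean clauses; $q\models\langle\langle A\rangle\rangle\varphi$ iff there is a strategy profile $s$ for $A$ such that every $\rho\in\mathsf{Out}(q,s)$ satisfies $\varphi$, where $\rho\models\mathbf{X}\Phi$ iff $\rho[1]\models\Phi$, $\rho\models\Phi_1\mathbf{U}\Phi_2$ iff some $j$ has $\rho[j]\models\Phi_2$ and $\rho[i]\models\Phi_1$ for all $i<j$, and $\rho\models\mathbf{G}\Phi$ iff $\rho[j]\models\Phi$ for all $j$. $C\models\Phi$ iff every initial state of $C$ satisfies $\Phi$. A sample $\mathcal{S}=(P,N)$ consists of two finite sets $P,N$ of CGSs all having the same agent set $\mathsf{Ag}$; its size is $|\mathcal{S}|=\sum_{C\in P\cup N}|C|$. An ATL formula $\Phi$ is consistent with $\mathcal{S}$ if $C\models\Phi$ for all $C\in P$ and $C\not\models\Phi$ for all $C\in N$. *)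

theory Defs
  imports "HOL-Library.FuncSet" "HOL-Computational_Algebra.Polynomial"
begin

section \<open>Concurrent game structures\<close>

text \<open>
  The agents are \<open>1, \<dots>, k\<close>. A tuple of actions indexed by a set \<open>A\<close> of agents is an extensional
  function on \<open>A\<close>. The functions \<open>label\<close>, \<open>moves\<close> and \<open>trans\<close> matter only on states, agents and
  available tuples.
\<close>

record ('q, 'p) cgs =
  states :: "'q set"
  inits :: "'q set"
  num_agents :: nat
  props :: "'p set"
  label :: "'q \<Rightarrow> 'p set"
  moves :: "'q \<Rightarrow> nat \<Rightarrow> nat"
  trans :: "'q \<Rightarrow> (nat \<Rightarrow> nat) \<Rightarrow> 'q"

definition agents :: "('q, 'p) cgs \<Rightarrow> nat set" where
  "agents C = {1..num_agents C}"

definition act :: "('q, 'p) cgs \<Rightarrow> nat set \<Rightarrow> 'q \<Rightarrow> (nat \<Rightarrow> nat) set" where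
  "act C A q = (\<Pi>\<^sub>E a\<in>A. {1..moves C q a})"

definition cgs :: "('q, 'p) cgs \<Rightarrow> bool" where
  "cgs C \<longleftrightarrow>
     finite (states C) \<and> inits C \<subseteq> states C \<and> num_agents C \<ge> 1 \<and> finite (props C) \<and>
     (\<forall>q\<in>states C. label C q \<subseteq> props C \<and> (\<forall>a\<in>agents C. moves C q a \<ge> 1) \<and>
        (\<forall>\<alpha>\<in>act C (agents C) q. trans C q \<alpha> \<in> states C))"

definition all_act :: "('q, 'p) cgs \<Rightarrow> ('q \<times> (nat \<Rightarrow> nat)) set" where
  "all_act C = (SIGMA q:states C. act C (agents C) q)"

definition cgs_size :: "('q, 'p) cgs \<Rightarrow> nat" where
  "cgs_size C = card (all_act C) + card (props C) + card (agents C)"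

definition succs :: "('q, 'p) cgs \<Rightarrow> nat set \<Rightarrow> 'q \<Rightarrow> (nat \<Rightarrow> nat) \<Rightarrow> 'q set" where
  "succs C A q \<alpha> =
     {trans C q (\<lambda>a. if a \<in> A then \<alpha> a else \<alpha>' a) | \<alpha>'. \<alpha>' \<in> act C (agents C - A) q}"

definition strategy :: "('q, 'p) cgs \<Rightarrow> nat \<Rightarrow> ('q list \<Rightarrow> nat) \<Rightarrow> bool" where
  "strategy C a \<sigma> \<longleftrightarrow>
     (\<forall>h. h \<noteq> [] \<longrightarrow> set h \<subseteq> states C \<longrightarrow> 1 \<le> \<sigma> h \<and> \<sigma> h \<le> moves C (last h) a)"

definition outcomes ::
    "('q, 'p) cgs \<Rightarrow> nat set \<Rightarrow> (nat \<Rightarrow> 'q list \<Rightarrow> nat) \<Rightarrow> 'q \<Rightarrow> (nat \<Rightarrow> 'q) set" where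
  "outcomes C A s q =
     {\<rho>. \<rho> 0 = q \<and>
         (\<forall>i. \<rho> (Suc i) \<in> succs C A (\<rho> i) (\<lambda>a\<in>A. s a (map \<rho> [0..<Suc i])))}"


section \<open>ATL\<close>

datatype 'p atl =
    Prop 'p
  | Neg "'p atl"
  | Conj "'p atl" "'p atl"
  | Coal "nat set" "'p atl_path"
and 'p atl_path =
    Next "'p atl"
  | Until "'p atl" "'p atl"
  | Always "'p atl"

text \<open>Formulas over the propositions \<open>AP\<close> and the agents \<open>Ag\<close>.\<close>

primrec atl_over :: "'p set \<Rightarrow> nat set \<Rightarrow> 'p atl \<Rightarrow> bool"
  and path_over :: "'p set \<Rightarrow> nat set \<Rightarrow> 'p atl_path \<Rightarrow> bool" where
  "atl_over AP Ag (Prop p) \<longleftrightarrow> p \<in> AP"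
| "atl_over AP Ag (Neg \<Phi>) \<longleftrightarrow> atl_over AP Ag \<Phi>"
| "atl_over AP Ag (Conj \<Phi> \<Psi>) \<longleftrightarrow> atl_over AP Ag \<Phi> \<and> atl_over AP Ag \<Psi>"
| "atl_over AP Ag (Coal A \<phi>) \<longleftrightarrow> A \<subseteq> Ag \<and> path_over AP Ag \<phi>"
| "path_over AP Ag (Next \<Phi>) \<longleftrightarrow> atl_over AP Ag \<Phi>"
| "path_over AP Ag (Until \<Phi> \<Psi>) \<longleftrightarrow> atl_over AP Ag \<Phi> \<and> atl_over AP Ag \<Psi>"
| "path_over AP Ag (Always \<Phi>) \<longleftrightarrow> atl_over AP Ag \<Phi>"

primrec sat :: "('q, 'p) cgs \<Rightarrow> 'q \<Rightarrow> 'p atl \<Rightarrow> bool"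
  and path_sat :: "('q, 'p) cgs \<Rightarrow> (nat \<Rightarrow> 'q) \<Rightarrow> 'p atl_path \<Rightarrow> bool" where
  "sat C q (Prop p) \<longleftrightarrow> p \<in> label C q"
| "sat C q (Neg \<Phi>) \<longleftrightarrow> \<not> sat C q \<Phi>"
| "sat C q (Conj \<Phi> \<Psi>) \<longleftrightarrow> sat C q \<Phi> \<and> sat C q \<Psi>"
| "sat C q (Coal A \<phi>) \<longleftrightarrow>
     (\<exists>s. (\<forall>a\<in>A. strategy C a (s a)) \<and> (\<forall>\<rho>\<in>outcomes C A s q. path_sat C \<rho> \<phi>))"
| "path_sat C \<rho> (Next \<Phi>) \<longleftrightarrow> sat C (\<rho> 1) \<Phi>"
| "path_sat C \<rho> (Until \<Phi> \<Psi>) \<longleftrightarrow> (\<exists>j. sat C (\<rho> j) \<Psi> \<and> (\<forall>i<j. sat C (\<rho> i) \<Phi>))"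
| "path_sat C \<rho> (Always \<Phi>) \<longleftrightarrow> (\<forall>j. sat C (\<rho> j) \<Phi>)"

definition models :: "('q, 'p) cgs \<Rightarrow> 'p atl \<Rightarrow> bool" where
  "models C \<Phi> \<longleftrightarrow> (\<forall>q\<in>inits C. sat C q \<Phi>)"


section \<open>Samples\<close>

type_synonym ('q, 'p) sample = "('q, 'p) cgs set \<times> ('q, 'p) cgs set"

definition sample :: "('q, 'p) sample \<Rightarrow> bool" where
  "sample S \<longleftrightarrow> (case S of (P, N) \<Rightarrow>
     finite P \<and> finite N \<and> (\<forall>C\<in>P \<union> N. cgs C) \<and>
     (\<forall>C\<in>P \<union> N. \<forall>D\<in>P \<union> N. agents C = agents D))"

definition sample_size :: "('q, 'p) sample \<Rightarrow> nat" where
  "sample_size S = (case S of (P, N) \<Rightarrow> \<Sum>C\<in>P \<union> N. cgs_size C)"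

definition sample_props :: "('q, 'p) sample \<Rightarrow> 'p set" where
  "sample_props S = (case S of (P, N) \<Rightarrow> \<Union>C\<in>P \<union> N. props C)"

definition sample_agents :: "('q, 'p) sample \<Rightarrow> nat set" where
  "sample_agents S = (case S of (P, N) \<Rightarrow> \<Union>C\<in>P \<union> N. agents C)"

definition consistent :: "'p atl \<Rightarrow> ('q, 'p) sample \<Rightarrow> bool" where
  "consistent \<Phi> S \<longleftrightarrow> (case S of (P, N) \<Rightarrow>
     (\<forall>C\<in>P. models C \<Phi>) \<and> (\<forall>C\<in>N. \<not> models C \<Phi>))"


section \<open>Polynomial time\<close>

text \<open>
  The machine model is the language WHILE over binary trees of N. D. Jones, ``Computability and
  Complexity from a Programming Perspective'' (MIT Press, 1997), with his time measure, which
  charges one unit for each elementary operation; the conditional is primitive here. Its only test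
  asks whether a tree is a leaf. Trees can be kept as shared pointer structures (each evaluation of
  \<open>Mk\<close> allocates one cell), so every step is a constant-time pointer operation, and the decision
  problems solvable in polynomial time are the same as for Turing machines (loc. cit., Part IV).
\<close>

datatype tree = Leaf | Node tree tree

primrec left :: "tree \<Rightarrow> tree" where
  "left Leaf = Leaf"
| "left (Node l r) = l"

primrec right :: "tree \<Rightarrow> tree" where
  "right Leaf = Leaf"
| "right (Node l r) = r"

datatype expr = Var nat | Lf | Mk expr expr | Hd expr | Tl expr

datatype com = Assign nat expr | Seq com com | Cond expr com com | While expr com

type_synonym store = "nat \<Rightarrow> tree"

primrec eval :: "expr \<Rightarrow> store \<Rightarrow> tree" where
  "eval (Var x) s = s x"
| "eval Lf s = Leaf"
| "eval (Mk e f) s = Node (eval e s) (eval f s)"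
| "eval (Hd e) s = left (eval e s)"
| "eval (Tl e) s = right (eval e s)"

primrec cost :: "expr \<Rightarrow> nat" where
  "cost (Var x) = 1"
| "cost Lf = 1"
| "cost (Mk e f) = 1 + cost e + cost f"
| "cost (Hd e) = 1 + cost e"
| "cost (Tl e) = 1 + cost e"

text \<open>\<open>exec c s t s'\<close>: started in store \<open>s\<close>, command \<open>c\<close> halts after \<open>t\<close> steps in store \<open>s'\<close>.\<close>

inductive exec :: "com \<Rightarrow> store \<Rightarrow> nat \<Rightarrow> store \<Rightarrow> bool" where
  Assign: "exec (Assign x e) s (1 + cost e) (s(x := eval e s))"
| Seq: "exec c s t s' \<Longrightarrow> exec d s' u s'' \<Longrightarrow> exec (Seq c d) s (1 + t + u) s''"
| CondTrue: "eval e s \<noteq> Leaf \<Longrightarrow> exec c s t s' \<Longrightarrow> exec (Cond e c d) s (1 + cost e + t) s'"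
| CondFalse: "eval e s = Leaf \<Longrightarrow> exec d s t s' \<Longrightarrow> exec (Cond e c d) s (1 + cost e + t) s'"
| WhileFalse: "eval e s = Leaf \<Longrightarrow> exec (While e c) s (1 + cost e) s"
| WhileTrue: "eval e s \<noteq> Leaf \<Longrightarrow> exec c s t s' \<Longrightarrow> exec (While e c) s' u s'' \<Longrightarrow>
    exec (While e c) s (1 + cost e + t + u) s''"

lemma exec_deterministic:
  "exec c s t s' \<Longrightarrow> exec c s u s'' \<Longrightarrow> t = u \<and> s' = s''"
proof (induction arbitrary: u s'' rule: exec.induct)
  case (Assign x e s)
  then show ?case by (auto elim: exec.cases)
next
  case (Seq c s t s1 d v s2)
  from Seq.prems show ?case by cases (use Seq.IH in blast)
next
  case (CondTrue e s c t s1 d)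
  from CondTrue.prems show ?case by cases (use CondTrue in blast)+
next
  case (CondFalse e s d t s1 c)
  from CondFalse.prems show ?case by cases (use CondFalse in blast)+
next
  case (WhileFalse e s c)
  from WhileFalse.prems show ?case by cases (use WhileFalse in blast)+
next
  case (WhileTrue e s c t s1 v s2)
  from WhileTrue.prems show ?case by cases (use WhileTrue in blast)+
qed

text \<open>The input is placed in variable \<open>0\<close>, all other variables are initially \<open>Leaf\<close>.\<close>

definition input :: "tree \<Rightarrow> store" where
  "input d = (\<lambda>x. if x = 0 then d else Leaf)"

text \<open>
  \<open>codes x d\<close> means that \<open>d\<close> is an encoding of the instance \<open>x\<close>. An instance may have several
  encodings, and the program has to answer correctly on each of them.
\<close>

definition poly_time_decidable ::
    "('a \<Rightarrow> bool) \<Rightarrow> ('a \<Rightarrow> tree \<Rightarrow> bool) \<Rightarrow> ('a \<Rightarrow> nat) \<Rightarrow> ('a \<Rightarrow> bool) \<Rightarrow> bool" where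
  "poly_time_decidable inst codes size_of yes \<longleftrightarrow>
     (\<exists>(c :: com) (p :: nat poly). \<forall>x. inst x \<longrightarrow> (\<forall>d. codes x d \<longrightarrow>
        (\<exists>t s. exec c (input d) t s \<and> t \<le> poly p (size_of x) \<and> (s 0 \<noteq> Leaf \<longleftrightarrow> yes x))))"


section \<open>Encoding of samples\<close>

primrec tree_of_list :: "tree list \<Rightarrow> tree" where
  "tree_of_list [] = Leaf"
| "tree_of_list (x # xs) = Node x (tree_of_list xs)"

text \<open>
  Numbers are encoded in unary. All numbers occurring in the encoding of a sample are bounded by
  its size, and running times are measured in that size rather than in the size of the encoding.
\<close>

definition tree_of_nat :: "nat \<Rightarrow> tree" where
  "tree_of_nat n = tree_of_list (replicate n Leaf)"

text \<open>The name of a state or proposition is its position in a given enumeration.\<close>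

definition position :: "'a list \<Rightarrow> 'a \<Rightarrow> nat" where
  "position xs x = length (takeWhile (\<lambda>y. y \<noteq> x) xs)"

definition tree_of_sublist :: "'a list \<Rightarrow> 'a set \<Rightarrow> tree" where
  "tree_of_sublist xs A =
     tree_of_list (map (\<lambda>x. tree_of_nat (position xs x)) (filter (\<lambda>x. x \<in> A) xs))"

text \<open>All tuples of actions of \<open>1, \<dots>, k\<close> at \<open>q\<close> as lists of length \<open>k\<close>, in lexicographic order.\<close>

definition act_lists :: "('q, 'p) cgs \<Rightarrow> 'q \<Rightarrow> nat list list" where
  "act_lists C q = product_lists (map (\<lambda>a. [1..<Suc (moves C q a)]) [1..<Suc (num_agents C)])"

definition act_of_list :: "('q, 'p) cgs \<Rightarrow> nat list \<Rightarrow> nat \<Rightarrow> nat" where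
  "act_of_list C \<alpha>s = (\<lambda>a\<in>agents C. \<alpha>s ! (a - 1))"

definition tree_of_state :: "'p list \<Rightarrow> 'q list \<Rightarrow> ('q, 'p) cgs \<Rightarrow> 'q \<Rightarrow> tree" where
  "tree_of_state ps qs C q = tree_of_list
     [tree_of_sublist ps (label C q),
      tree_of_list (map (\<lambda>a. tree_of_nat (moves C q a)) [1..<Suc (num_agents C)]),
      tree_of_list (map (\<lambda>\<alpha>s.
          Node (tree_of_list (map tree_of_nat \<alpha>s))
               (tree_of_nat (position qs (trans C q (act_of_list C \<alpha>s)))))
        (act_lists C q))]"

definition tree_of_cgs :: "'p list \<Rightarrow> 'q list \<Rightarrow> ('q, 'p) cgs \<Rightarrow> tree" where
  "tree_of_cgs ps qs C = tree_of_list
     [tree_of_nat (num_agents C),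
      tree_of_sublist ps (props C),
      tree_of_sublist qs (inits C),
      tree_of_list (map (tree_of_state ps qs C) qs)]"

definition enumerates :: "'a list \<Rightarrow> 'a set \<Rightarrow> bool" where
  "enumerates xs A \<longleftrightarrow> distinct xs \<and> set xs = A"

text \<open>
  The encoding depends on the chosen enumerations of \<open>P\<close>, of \<open>N\<close>, of the propositions (a
  common one for the whole sample) and of the states of each structure.
\<close>

definition codes_sample :: "('q, 'p) sample \<Rightarrow> tree \<Rightarrow> bool" where
  "codes_sample S d \<longleftrightarrow> (case S of (P, N) \<Rightarrow>
     \<exists>ps Cs Ds qs. enumerates ps (sample_props S) \<and> enumerates Cs P \<and> enumerates Ds N \<and>
       (\<forall>C\<in>P \<union> N. enumerates (qs C) (states C)) \<and>
       d = Node (tree_of_list (map (\<lambda>C. tree_of_cgs ps (qs C) C) Cs))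
                (tree_of_list (map (\<lambda>C. tree_of_cgs ps (qs C) C) Ds)))"

lemma ex_codes_sample:
  assumes "sample S"
  shows "\<exists>d. codes_sample S d"
proof -
  obtain P N where S: "S = (P, N)" by fastforce
  have fin: "finite P" "finite N" and cgs: "\<forall>C\<in>P \<union> N. cgs C"
    using assms by (auto simp: sample_def S)
  have "finite (sample_props S)"
    using fin cgs by (auto simp: sample_props_def S cgs_def)
  then obtain ps where ps: "enumerates ps (sample_props S)"
    using finite_distinct_list unfolding enumerates_def by metis
  obtain Cs Ds where Cs: "enumerates Cs P" and Ds: "enumerates Ds N"
    using fin finite_distinct_list unfolding enumerates_def by metis
  have "\<forall>C\<in>P \<union> N. \<exists>xs. enumerates xs (states C)"
    using cgs finite_distinct_list unfolding enumerates_def cgs_def by metis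
  then obtain qs where qs: "\<forall>C\<in>P \<union> N. enumerates (qs C) (states C)"
    by metis
  show ?thesis
    unfolding codes_sample_def S prod.case using ps Cs Ds qs S by blast
qed

end

theory Submission
  imports Defs
begin

text \<open>
  Two states satisfy the same ATL formulas iff they are alternating bisimilar: matching single moves
  suffices to translate a strategy with memory history by history, and conversely finitely many
  states are separated by \<open>X\<close>-formulas. Boolean combinations then show that a consistent
  formula exists iff there is a proposition and every negative structure has an initial state that is
  not equivalent to any initial state of a positive one. The greatest bisimulation is computed by
  partition refinement. Although there are exponentially many coalitions, for a given pair of states
  only the agents with at least two actions at one of them matter, so the number of relevant
  coalitions is bounded by the product of the numbers of action tuples at both states.

  For the time bound, polynomial-time functions on trees are shown to be closed under composition,
  pairing, conditionals, and iteration along a list with polynomially bounded intermediate results.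
\<close>

section \<open>Polynomial-time functions on trees\<close>

text \<open>The grammar has no constants, so over an empty set of propositions there is no formula
  at all, not even for the empty sample; this is why the criterion asks for a proposition. The best
  candidate formula holds exactly at those initial states of the sample that are equivalent to a
  positive one: a consistent formula must hold there anyway, and every further state only makes it
  harder to reject a negative structure. Such a formula exists because separation is only required
  relative to a finite set of states.

  The time bound is claimed in the size of the sample, while the closure properties speak of the
  size of the encoding tree. The two are polynomially related because every state has at least one
  action tuple and the action counts at a state multiply to its number of tuples; this is what makes
  unary numbers affordable.\<close>

primrec list_of_tree :: "tree \<Rightarrow> tree list" where
  "list_of_tree Leaf = []"
| "list_of_tree (Node l r) = l # list_of_tree r"

lemma list_of_tree_of_list [simp]: "list_of_tree (tree_of_list xs) = xs"
  by (induction xs) auto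

lemma tree_of_list_of_tree [simp]: "tree_of_list (list_of_tree t) = t"
  by (induction t) auto

lemma tree_of_list_eq_Leaf [simp]: "tree_of_list xs = Leaf \<longleftrightarrow> xs = []"
  by (cases xs) auto

lemma list_of_tree_eq_Nil [simp]: "list_of_tree t = [] \<longleftrightarrow> t = Leaf"
  by (cases t) auto

lemma size_tree_of_list: "size (tree_of_list xs) = length xs + sum_list (map size xs)"
  by (induction xs) auto

lemma size_list_of_tree:
  "size t = length (list_of_tree t) + sum_list (map size (list_of_tree t))"
  by (induction t) auto

lemma length_list_of_tree_le: "length (list_of_tree t) \<le> size t"
  by (induction t) auto

lemma size_elem_list_of_tree: "y \<in> set (list_of_tree t) \<Longrightarrow> size y \<le> size t"
  by (induction t) auto

lemma size_tree_of_list_le: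
  assumes "length xs \<le> n" "\<And>x. x \<in> set xs \<Longrightarrow> size x \<le> m"
  shows "size (tree_of_list xs) \<le> n + n * m"
proof -
  have "sum_list (map size xs) \<le> length xs * m"
    using assms(2) by (induction xs) (auto simp: add_mono)
  with assms(1) show ?thesis
    unfolding size_tree_of_list using mult_le_mono1[of "length xs" n m] by linarith
qed

lemma size_left_le: "size (left t) \<le> size t" and size_right_le: "size (right t) \<le> size t"
  by (cases t; simp)+


section \<open>Polynomial bounds in the size of a tree\<close>

lemma poly_nat_mono:
  fixes p :: "nat poly"
  assumes "m \<le> n"
  shows "poly p m \<le> poly p n"
  by (induction p) (auto simp: assms intro!: add_mono mult_le_mono)

text \<open>Bounds are functions of the tree itself, so that expressions such as
  \<open>b (f x)\<close> can be bounded by composition rules, without ever naming a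
  polynomial.\<close>

definition pbound :: "(tree \<Rightarrow> nat) \<Rightarrow> bool" where
  "pbound b \<longleftrightarrow> (\<exists>p :: nat poly. \<forall>x. b x \<le> poly p (size x))"

lemma pbound_le: "pbound b \<Longrightarrow> (\<And>x. a x \<le> b x) \<Longrightarrow> pbound a"
  unfolding pbound_def using le_trans by blast

lemma pbound_const: "pbound (\<lambda>x. n)"
  unfolding pbound_def by (rule exI[of _ "[:n:]"]) simp

lemma pbound_size: "pbound size"
  unfolding pbound_def by (rule exI[of _ "[:0, 1:]"]) simp

lemma pbound_add:
  assumes "pbound a" "pbound b"
  shows "pbound (\<lambda>x. a x + b x)"
proof -
  obtain p q where "\<forall>x. a x \<le> poly p (size x)" "\<forall>x. b x \<le> poly q (size x)"
    using assms unfolding pbound_def by blast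
  then have "\<forall>x. a x + b x \<le> poly (p + q) (size x)" by (simp add: add_mono)
  then show ?thesis unfolding pbound_def by blast
qed

lemma pbound_mult:
  assumes "pbound a" "pbound b"
  shows "pbound (\<lambda>x. a x * b x)"
proof -
  obtain p q where "\<forall>x. a x \<le> poly p (size x)" "\<forall>x. b x \<le> poly q (size x)"
    using assms unfolding pbound_def by blast
  then have "\<forall>x. a x * b x \<le> poly (p * q) (size x)" by (simp add: mult_le_mono)
  then show ?thesis unfolding pbound_def by blast
qed

lemma pbound_poly:
  assumes "pbound b"
  shows "pbound (\<lambda>x. poly p (b x))"
proof -
  obtain q where "\<forall>x. b x \<le> poly q (size x)"
    using assms unfolding pbound_def by blast
  then have "\<forall>x. poly p (b x) \<le> poly (pcompose p q) (size x)"
    by (simp add: poly_pcompose poly_nat_mono)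
  then show ?thesis unfolding pbound_def by blast
qed

lemma pbound_comp:
  assumes "pbound b" "pbound (\<lambda>x. size (f x))"
  shows "pbound (\<lambda>x. b (f x))"
proof -
  obtain p where "\<forall>x. b x \<le> poly p (size x)"
    using assms unfolding pbound_def by blast
  then show ?thesis
    by (intro pbound_le[OF pbound_poly[OF assms(2), of p]]) simp
qed

lemmas pbound_intros = pbound_const pbound_size pbound_add pbound_mult


text \<open>
  Polynomial growth of the output has to be required separately: because of sharing, a program can
  build a tree of exponential size in polynomial time.
\<close>

definition ptime :: "(tree \<Rightarrow> tree) \<Rightarrow> bool" where
  "ptime f \<longleftrightarrow> pbound (\<lambda>x. size (f x)) \<and>
     (\<exists>c b. pbound b \<and> (\<forall>s. \<exists>t\<le>b (s 0). exec c s t (s(0 := f (s 0)))))"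

lemma ptimeI:
  assumes "pbound (\<lambda>x. size (f x))" "pbound b"
    "\<And>s. \<exists>t\<le>b (s 0). exec c s t (s(0 := f (s 0)))"
  shows "ptime f"
  using assms unfolding ptime_def by blast

lemma ptimeE:
  assumes "ptime f"
  obtains b c where "pbound (\<lambda>x. size (f x))" "pbound b"
    "\<And>s. \<exists>t\<le>b (s 0). exec c s t (s(0 := f (s 0)))"
  using assms unfolding ptime_def by blast

lemma ptime_size: "ptime f \<Longrightarrow> pbound (\<lambda>x. size (f x))"
  by (simp add: ptime_def)

lemma ptime_expr:
  assumes "\<And>s. eval e s = f (s 0)" "pbound (\<lambda>x. size (f x))"
  shows "ptime f"
proof (rule ptimeI[OF assms(2) pbound_const])
  fix s
  show "\<exists>t\<le>1 + cost e. exec (Assign 0 e) s t (s(0 := f (s 0)))"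
    using exec.Assign[of 0 e s] unfolding assms(1) by blast
qed

lemma ptime_id: "ptime (\<lambda>x. x)"
  by (rule ptime_expr[of "Var 0"]) (auto simp: pbound_size)

lemma ptime_Leaf: "ptime (\<lambda>x. Leaf)"
  by (rule ptime_expr[of Lf]) (auto simp: pbound_const)

lemma ptime_comp:
  assumes "ptime g" "ptime f"
  shows "ptime (\<lambda>x. g (f x))"
proof -
  from assms(1) obtain c b where g: "pbound (\<lambda>x. size (g x))" "pbound b"
    "\<And>s. \<exists>t\<le>b (s 0). exec c s t (s(0 := g (s 0)))" by (rule ptimeE) (rule that)
  from assms(2) obtain d a where f: "pbound (\<lambda>x. size (f x))" "pbound a"
    "\<And>s. \<exists>t\<le>a (s 0). exec d s t (s(0 := f (s 0)))" by (rule ptimeE) (rule that)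
  show ?thesis
  proof (rule ptimeI)
    show "pbound (\<lambda>x. size (g (f x)))" by (rule pbound_comp[OF g(1) f(1)])
    show "pbound (\<lambda>x. 1 + a x + b (f x))"
      by (intro pbound_intros f(2) pbound_comp[OF g(2) f(1)])
    fix s
    obtain t where t: "t \<le> a (s 0)" "exec d s t (s(0 := f (s 0)))" using f(3) by blast
    obtain u where u: "u \<le> b (f (s 0))" "exec c (s(0 := f (s 0))) u (s(0 := g (f (s 0))))"
      using g(3)[of "s(0 := f (s 0))"] by auto
    show "\<exists>t\<le>1 + a (s 0) + b (f (s 0)). exec (Seq d c) s t (s(0 := g (f (s 0))))"
      using exec.Seq[OF t(2) u(2)] t(1) u(1) by (intro exI[of _ "1 + t + u"]) auto
  qed
qed

lemma ptime_left:
  assumes "ptime f"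
  shows "ptime (\<lambda>x. left (f x))"
proof (rule ptime_comp[OF _ assms])
  show "ptime left"
    by (rule ptime_expr[of "Hd (Var 0)"]) (auto intro: pbound_le[OF pbound_size] size_left_le)
qed

lemma ptime_right:
  assumes "ptime f"
  shows "ptime (\<lambda>x. right (f x))"
proof (rule ptime_comp[OF _ assms])
  show "ptime right"
    by (rule ptime_expr[of "Tl (Var 0)"]) (auto intro: pbound_le[OF pbound_size] size_right_le)
qed

text \<open>Variable \<open>1\<close> serves as a stack, so that no other variable is ever needed.\<close>

lemma ptime_Node:
  assumes "ptime f" "ptime g"
  shows "ptime (\<lambda>x. Node (f x) (g x))"
proof -
  from assms(1) obtain c a where f: "pbound (\<lambda>x. size (f x))" "pbound a"
    "\<And>s. \<exists>t\<le>a (s 0). exec c s t (s(0 := f (s 0)))" by (rule ptimeE) (rule that)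
  from assms(2) obtain d b where g: "pbound (\<lambda>x. size (g x))" "pbound b"
    "\<And>s. \<exists>t\<le>b (s 0). exec d s t (s(0 := g (s 0)))" by (rule ptimeE) (rule that)
  \<comment> \<open>\<open>e1\<close> pushes variable \<open>0\<close>, first the input and later
    \<open>f x\<close>; \<open>e2\<close> recovers the input from below \<open>f x\<close>;
    \<open>e3\<close> pairs the two results; \<open>e4\<close> pops both entries, so that variable
    \<open>1\<close> is restored as \<open>ptime\<close> demands.\<close>
  define e1 where "e1 = Mk (Var 0) (Var 1)"
  define e2 where "e2 = Hd (Tl (Var 1))"
  define e3 where "e3 = Mk (Hd (Var 1)) (Var 0)"
  define e4 where "e4 = Tl (Tl (Var 1))"
  define C where "C = Seq (Assign 1 e1) (Seq c (Seq (Assign 1 e1) (Seq (Assign 0 e2)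
    (Seq d (Seq (Assign 0 e3) (Assign 1 e4))))))"
  show ?thesis
  proof (rule ptimeI)
    show "pbound (\<lambda>x. size (Node (f x) (g x)))"
      by simp (intro pbound_intros pbound_le[OF pbound_add[OF pbound_const[of 1] pbound_add[OF f(1) g(1)]]]; simp)
    show "pbound (\<lambda>x. 40 + a x + b x)"
      by (intro pbound_intros f(2) g(2))
    fix s :: store
    define x where "x = s 0"
    define s1 where "s1 = s(1 := Node x (s 1))"
    define s2 where "s2 = s1(0 := f x)"
    define s3 where "s3 = s2(1 := Node (f x) (s1 1))"
    define s4 where "s4 = s3(0 := x)"
    define s5 where "s5 = s4(0 := g x)"
    define s6 where "s6 = s5(0 := Node (f x) (g x))"
    have 1: "exec (Assign 1 e1) s (1 + cost e1) s1"
      using exec.Assign[of 1 e1 s] by (simp add: e1_def s1_def x_def)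
    obtain t where t: "t \<le> a x" "exec c s1 t s2"
      using f(3)[of s1] by (auto simp: s1_def s2_def x_def)
    have 3: "exec (Assign 1 e1) s2 (1 + cost e1) s3"
      using exec.Assign[of 1 e1 s2] by (simp add: e1_def s3_def s2_def)
    have 4: "exec (Assign 0 e2) s3 (1 + cost e2) s4"
      using exec.Assign[of 0 e2 s3] by (simp add: e2_def s4_def s3_def s2_def s1_def)
    obtain u where u: "u \<le> b x" "exec d s4 u s5"
      using g(3)[of s4] by (auto simp: s5_def s4_def)
    have 6: "exec (Assign 0 e3) s5 (1 + cost e3) s6"
      using exec.Assign[of 0 e3 s5] by (simp add: e3_def s6_def s5_def s4_def s3_def)
    have 7: "exec (Assign 1 e4) s6 (1 + cost e4) (s(0 := Node (f x) (g x)))"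
      using exec.Assign[of 1 e4 s6]
      by (simp add: e4_def s6_def s5_def s4_def s3_def s2_def s1_def fun_upd_twist)
    note E = exec.Seq[OF 1 exec.Seq[OF t(2) exec.Seq[OF 3 exec.Seq[OF 4 exec.Seq[OF u(2)
      exec.Seq[OF 6 7]]]]]]
    show "\<exists>t\<le>40 + a (s 0) + b (s 0). exec C s t (s(0 := Node (f (s 0)) (g (s 0))))"
      using E t(1) u(1) unfolding C_def x_def
      by (intro exI conjI) (auto simp: e1_def e2_def e3_def e4_def)
  qed
qed

lemma ptime_cond:
  assumes "ptime h" "ptime f" "ptime g"
  shows "ptime (\<lambda>x. if h x \<noteq> Leaf then f x else g x)"
proof -
  \<comment> \<open>Running the program for \<open>h\<close> overwrites the input, so
    \<open>h x\<close> is first paired with \<open>x\<close>; \<open>?k\<close> tests the left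
    component and lets the branches work on the right one.\<close>
  let ?k = "\<lambda>x. if left x \<noteq> Leaf then f (right x) else g (right x)"
  from ptime_comp[OF assms(2) ptime_right[OF ptime_id]] obtain c a where
    f: "pbound (\<lambda>x. size (f (right x)))" "pbound a"
    "\<And>s. \<exists>t\<le>a (s 0). exec c s t (s(0 := f (right (s 0))))" by (rule ptimeE) (rule that)
  from ptime_comp[OF assms(3) ptime_right[OF ptime_id]] obtain d b where
    g: "pbound (\<lambda>x. size (g (right x)))" "pbound b"
    "\<And>s. \<exists>t\<le>b (s 0). exec d s t (s(0 := g (right (s 0))))" by (rule ptimeE) (rule that)
  have "ptime ?k"
  proof (rule ptimeI)
    show "pbound (\<lambda>x. size (?k x))"
      by (rule pbound_le[OF pbound_add[OF f(1) g(1)]]) auto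
    show "pbound (\<lambda>x. 3 + a x + b x)" by (intro pbound_intros f(2) g(2))
    fix s :: store
    obtain t where t: "t \<le> a (s 0)" "exec c s t (s(0 := f (right (s 0))))" using f(3) by blast
    obtain u where u: "u \<le> b (s 0)" "exec d s u (s(0 := g (right (s 0))))" using g(3) by blast
    show "\<exists>t\<le>3 + a (s 0) + b (s 0). exec (Cond (Hd (Var 0)) c d) s t (s(0 := ?k (s 0)))"
    proof (cases "left (s 0) = Leaf")
      case True
      then show ?thesis
        using exec.CondFalse[of "Hd (Var 0)" s, OF _ u(2)] u(1)
        by (intro exI[of _ "3 + u"]) (auto simp: eval_nat_numeral)
    next
      case False
      then show ?thesis
        using exec.CondTrue[of "Hd (Var 0)" s, OF _ t(2)] t(1)
        by (intro exI[of _ "3 + t"]) (auto simp: eval_nat_numeral)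
    qed
  qed
  from ptime_comp[OF this ptime_Node[OF assms(1) ptime_id]] show ?thesis
    unfolding left.simps right.simps .
qed

text \<open>Variable \<open>0\<close> holds the remaining list, the fixed parameter \<open>e\<close>
  and the accumulator. As \<open>B\<close> bounds the accumulator after every prefix,
  \<open>N\<close> bounds this tree in every round (the \<open>2\<close> are its two inner cells),
  and the single cost \<open>poly p N\<close> serves for all rounds. Each \<open>3\<close> is the
  cost of one loop test, \<open>1 + cost (Hd (Var 0))\<close>.\<close>

lemma exec_fold:
  assumes body: "\<And>s. \<exists>t\<le>poly p (size (s 0)). exec c s t
      (s(0 := Node (right (left (s 0))) (Node (left (right (s 0)))
        (f (left (right (s 0))) (left (left (s 0))) (right (right (s 0)))))))"
    and size: "\<And>us vs. ys = us @ vs \<Longrightarrow> size (fold (f e) us a) \<le> B"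
    and N: "size (tree_of_list ys) + size e + B + 2 \<le> N"
  shows "\<exists>t\<le>3 + length ys * (3 + poly p N).
    exec (While (Hd (Var 0)) c) (s(0 := Node (tree_of_list ys) (Node e a))) t
      (s(0 := Node Leaf (Node e (fold (f e) ys a))))"
  using size N
proof (induction ys arbitrary: a)
  case Nil
  then show ?case
    using exec.WhileFalse[of "Hd (Var 0)" "s(0 := Node Leaf (Node e a))" c]
    by (intro exI[of _ 3]) (simp_all add: numeral_3_eq_3 fun_upd_def)
next
  case (Cons y ys)
  let ?s = "s(0 := Node (tree_of_list (y # ys)) (Node e a))"
  let ?s' = "s(0 := Node (tree_of_list ys) (Node e (f e y a)))"
  obtain t where t: "t \<le> poly p (size (?s 0))" "exec c ?s t ?s'"
    using body[of ?s] by auto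
  have "size a \<le> B" using Cons.prems(1)[of "[]" "y # ys"] by simp
  then have "size (?s 0) \<le> N" using Cons.prems(2) by simp
  then have "t \<le> poly p N" using t(1) poly_nat_mono le_trans by blast
  have "\<exists>u\<le>3 + length ys * (3 + poly p N). exec (While (Hd (Var 0)) c) ?s' u
      (s(0 := Node Leaf (Node e (fold (f e) ys (f e y a)))))"
  proof (rule Cons.IH)
    fix us vs assume "ys = us @ vs"
    then show "size (fold (f e) us (f e y a)) \<le> B" using Cons.prems(1)[of "y # us" vs] by simp
  next
    show "size (tree_of_list ys) + size e + B + 2 \<le> N" using Cons.prems(2) by simp
  qed
  then obtain u where u: "u \<le> 3 + length ys * (3 + poly p N)"
    "exec (While (Hd (Var 0)) c) ?s' u (s(0 := Node Leaf (Node e (fold (f e) ys (f e y a)))))"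
    by blast
  have "exec (While (Hd (Var 0)) c) ?s (1 + cost (Hd (Var 0)) + t + u)
      (s(0 := Node Leaf (Node e (fold (f e) (y # ys) a))))"
    using exec.WhileTrue[OF _ t(2) u(2)] by simp
  moreover have "1 + cost (Hd (Var 0)) + t + u \<le> 3 + length (y # ys) * (3 + poly p N)"
    using \<open>t \<le> poly p N\<close> u(1) by simp
  ultimately show ?case by blast
qed

text \<open>Bounded iteration in the style of Cobham: a step that, say, doubles its argument would
  produce exponential size when iterated, so a bound on all intermediate accumulators is demanded.
  Functions of several arguments are expressed by one argument that is a nested pair.\<close>

lemma ptime_fold:
  assumes xs: "ptime xs" and a: "ptime a"
    and f: "ptime (\<lambda>z. f (left z) (left (right z)) (right (right z)))"
    and b: "pbound b"
    and size: "\<And>x us vs. list_of_tree (xs x) = us @ vs \<Longrightarrow> size (fold (f x) us (a x)) \<le> b x"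
  shows "ptime (\<lambda>x. fold (f x) (list_of_tree (xs x)) (a x))"
proof -
  let ?init = "\<lambda>x. Node (xs x) (Node x (a x))"
  let ?step = "\<lambda>z. Node (right (left z)) (Node (left (right z))
    (f (left (right z)) (left (left z)) (right (right z))))"
  let ?fin = "\<lambda>z. right (right z)"
  \<comment> \<open>The hypothesis reads a triple as parameter, entry, accumulator, whereas the loop
    keeps the list in front; the components have to be rearranged.\<close>
  have "ptime (\<lambda>z. f (left (right z)) (left (left z)) (right (right z)))"
    using ptime_comp[OF f, of "\<lambda>z. Node (left (right z)) (Node (left (left z)) (right (right z)))"]
    by (simp add: ptime_Node ptime_left ptime_right ptime_id)
  then have "ptime ?step" by (intro ptime_Node ptime_left ptime_right ptime_id)
  then obtain c p' where c: "pbound (\<lambda>z. size (?step z))" "pbound p'"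
    "\<And>s. \<exists>t\<le>p' (s 0). exec c s t (s(0 := ?step (s 0)))" by (rule ptimeE) (rule that)
  from c(2) obtain p where "\<And>x. p' x \<le> poly p (size x)" unfolding pbound_def by blast
  then have step: "\<exists>t\<le>poly p (size (s 0)). exec c s t (s(0 := ?step (s 0)))" for s
    using c(3)[of s] le_trans by blast
  have "ptime ?init" using xs a by (intro ptime_Node ptime_id)
  then obtain i bi where i: "pbound (\<lambda>x. size (?init x))" "pbound bi"
    "\<And>s. \<exists>t\<le>bi (s 0). exec i s t (s(0 := ?init (s 0)))" by (rule ptimeE) (rule that)
  define N where "N = (\<lambda>x. size (xs x) + size x + b x + 2)"
  have N: "pbound N" unfolding N_def by (intro pbound_intros ptime_size xs b)
  show ?thesis
  proof (rule ptimeI)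
    show "pbound (\<lambda>x. size (fold (f x) (list_of_tree (xs x)) (a x)))"
      by (rule pbound_le[OF b]) (rule size[of _ _ "[]"], simp)
    \<comment> \<open>The constant generously covers the two sequencing steps, the last loop test
      and the final assignment.\<close>
    show "pbound (\<lambda>x. 20 + bi x + size (xs x) * (3 + poly p (N x)))"
      by (intro pbound_intros i(2) ptime_size xs pbound_poly N)
    fix s :: store
    define x where "x = s 0"
    let ?r = "fold (f x) (list_of_tree (xs x)) (a x)"
    obtain t where t: "t \<le> bi x" "exec i s t (s(0 := ?init x))"
      using i(3)[of s] unfolding x_def by blast
    have "\<exists>t\<le>3 + length (list_of_tree (xs x)) * (3 + poly p (N x)).
      exec (While (Hd (Var 0)) c) (s(0 := Node (tree_of_list (list_of_tree (xs x))) (Node x (a x)))) t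
        (s(0 := Node Leaf (Node x ?r)))"
      by (rule exec_fold[where B="b x"]) (use step size in \<open>auto simp: N_def\<close>)
    then obtain u where u: "u \<le> 3 + length (list_of_tree (xs x)) * (3 + poly p (N x))"
      "exec (While (Hd (Var 0)) c) (s(0 := ?init x)) u (s(0 := Node Leaf (Node x ?r)))"
      by auto
    have u': "u \<le> 3 + size (xs x) * (3 + poly p (N x))"
      using u(1) mult_le_mono1[OF length_list_of_tree_le[of "xs x"], of "3 + poly p (N x)"] by linarith
    have fin: "exec (Assign 0 (Tl (Tl (Var 0)))) (s(0 := Node Leaf (Node x ?r))) 4 (s(0 := ?r))"
      using exec.Assign[of 0 "Tl (Tl (Var 0))" "s(0 := Node Leaf (Node x ?r))"]
      by (simp add: eval_nat_numeral)
    show "\<exists>t\<le>20 + bi (s 0) + size (xs (s 0)) * (3 + poly p (N (s 0))).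
       exec (Seq i (Seq (While (Hd (Var 0)) c) (Assign 0 (Tl (Tl (Var 0)))))) s t
         (s(0 := fold (f (s 0)) (list_of_tree (xs (s 0))) (a (s 0))))"
      unfolding x_def[symmetric]
    proof (intro exI conjI)
      show "1 + t + (1 + u + 4) \<le> 20 + bi x + size (xs x) * (3 + poly p (N x))"
        using t(1) u' by linarith
    qed (rule exec.Seq[OF t(2) exec.Seq[OF u(2) fin]])
  qed
qed


section \<open>Tests, list operations and bounded quantifiers\<close>

definition ptest :: "(tree \<Rightarrow> bool) \<Rightarrow> bool" where
  "ptest P \<longleftrightarrow> ptime (\<lambda>x. if P x then Node Leaf Leaf else Leaf)"

lemma if_not_swap: "(if \<not> b then x else y) = (if b then y else x)"
  by simp

lemma bool_tree_eq_Leaf [simp]: "(if b then Node l r else Leaf) = Leaf \<longleftrightarrow> \<not> b"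
  by simp

lemma ptime_if:
  assumes "ptest P" "ptime f" "ptime g"
  shows "ptime (\<lambda>x. if P x then f x else g x)"
  using ptime_cond[OF assms(1)[unfolded ptest_def] assms(2,3)]
  by simp

lemma ptest_nonleaf: "ptime f \<Longrightarrow> ptest (\<lambda>x. f x \<noteq> Leaf)"
  unfolding ptest_def by (intro ptime_cond ptime_Node ptime_Leaf)

lemma ptest_not: "ptest P \<Longrightarrow> ptest (\<lambda>x. \<not> P x)"
  using ptime_if[OF _ ptime_Leaf ptime_Node[OF ptime_Leaf ptime_Leaf], of P]
  unfolding ptest_def if_not_swap .

lemma ptest_leaf: "ptime f \<Longrightarrow> ptest (\<lambda>x. f x = Leaf)"
  using ptest_not[OF ptest_nonleaf] by simp

lemma ptest_conj:
  assumes "ptest P" "ptest Q"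
  shows "ptest (\<lambda>x. P x \<and> Q x)"
  unfolding ptest_def
  using ptime_if[OF assms(1) assms(2)[unfolded ptest_def] ptime_Leaf] by (simp add: if_if_eq_conj)

lemma ptest_imp: "ptest P \<Longrightarrow> ptest Q \<Longrightarrow> ptest (\<lambda>x. P x \<longrightarrow> Q x)"
  using ptest_not[OF ptest_conj[OF _ ptest_not]] by simp

text \<open>Folding with \<open>Node\<close> reverses a list, so reversal comes first and is used
  below to restore the order.\<close>

lemma ptime_rev:
  assumes "ptime f"
  shows "ptime (\<lambda>x. tree_of_list (rev (list_of_tree (f x))))"
proof -
  have *: "fold Node us (tree_of_list vs) = tree_of_list (rev us @ vs)" for us vs
    by (induction us arbitrary: vs) (auto simp flip: tree_of_list.simps)
  have "ptime (\<lambda>x. fold Node (list_of_tree x) Leaf)"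
  proof (rule ptime_fold[where b=size])
    fix x us vs assume "list_of_tree x = us @ vs"
    then have "x = tree_of_list (us @ vs)" using tree_of_list_of_tree by metis
    then show "size (fold Node us Leaf) \<le> size x"
      using *[of us "[]"] by (simp add: size_tree_of_list rev_map[symmetric] sum_list_rev)
  qed (intro ptime_Node ptime_left ptime_right ptime_id ptime_Leaf pbound_size)+
  from ptime_comp[OF this assms] show ?thesis using *[of _ "[]"] by simp
qed

lemma ptime_append:
  assumes "ptime f" "ptime g"
  shows "ptime (\<lambda>x. tree_of_list (list_of_tree (f x) @ list_of_tree (g x)))"
proof -
  let ?f = "\<lambda>x. tree_of_list (rev (list_of_tree (f x)))"
  have *: "fold Node us t = tree_of_list (rev us @ list_of_tree t)" for us t
    by (induction us arbitrary: t) auto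
  have "ptime (\<lambda>x. fold Node (list_of_tree (?f x)) (g x))"
  proof (rule ptime_fold[where b="\<lambda>x. size (f x) + size (g x)"])
    fix x us vs assume "list_of_tree (?f x) = us @ vs"
    then have "rev (list_of_tree (f x)) = us @ vs" by simp
    then have "list_of_tree (f x) = rev vs @ rev us"
      by (metis rev_append rev_rev_ident)
    then have "size (tree_of_list (rev us)) \<le> size (f x)"
      using size_list_of_tree[of "f x"] by (simp add: size_tree_of_list)
    then show "size (fold Node us (g x)) \<le> size (f x) + size (g x)"
      using size_list_of_tree[of "g x"] unfolding * by (simp add: size_tree_of_list)
  qed (intro ptime_Node ptime_left ptime_right ptime_id ptime_rev pbound_add ptime_size assms)+
  then show ?thesis by (simp add: *)
qed

text \<open>Map, filter and the bounded quantifiers are all derived from this loop. The accumulator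
  stays small because each entry \<open>y\<close> adds the output of \<open>f\<close> on
  \<open>Node x y\<close>, whose size is at most \<open>1 + size x + size (xs x)\<close>.\<close>

lemma ptime_concat_map:
  assumes xs: "ptime xs" and f: "ptime (\<lambda>z. f (left z) (right z))"
  shows "ptime (\<lambda>x. tree_of_list (concat (map (\<lambda>y. list_of_tree (f x y)) (list_of_tree (xs x)))))"
proof -
  let ?xs = "\<lambda>x. tree_of_list (rev (list_of_tree (xs x)))"
  let ?step = "\<lambda>x y a. tree_of_list (list_of_tree (f x y) @ list_of_tree a)"
  have *: "fold (?step x) us (tree_of_list vs) =
      tree_of_list (concat (map (\<lambda>y. list_of_tree (f x y)) (rev us)) @ vs)" for x us vs
    by (induction us arbitrary: vs) auto
  obtain p where p: "\<And>z. size (f (left z) (right z)) \<le> poly p (size z)"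
    using ptime_size[OF f] unfolding pbound_def by blast
  define b where "b = (\<lambda>x. size (xs x) * poly p (1 + size x + size (xs x)))"
  have size_step: "size (?step x y a) = size (f x y) + size a" for x y a
    using size_list_of_tree[of "f x y"] size_list_of_tree[of a] by (simp add: size_tree_of_list)
  have "ptime (\<lambda>x. fold (?step x) (list_of_tree (?xs x)) Leaf)"
  proof (rule ptime_fold[where b=b])
    show "pbound b" unfolding b_def by (intro pbound_intros pbound_poly ptime_size xs)
    show "ptime (\<lambda>z. ?step (left z) (left (right z)) (right (right z)))"
    proof (intro ptime_append ptime_right ptime_id)
      show "ptime (\<lambda>z. f (left z) (left (right z)))"
        using ptime_comp[OF f, of "\<lambda>z. Node (left z) (left (right z))"]
        by (simp add: ptime_Node ptime_left ptime_right ptime_id)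
    qed
    fix x us vs assume "list_of_tree (?xs x) = us @ vs"
    then have us: "rev (list_of_tree (xs x)) = us @ vs" by simp
    have le: "size (fold (?step x) us a) \<le> size a + length us * poly p (1 + size x + size (xs x))"
      if "\<forall>y\<in>set us. size y \<le> size (xs x)" for a
      using that
    proof (induction us arbitrary: a)
      case (Cons y us)
      have "size (f x y) \<le> poly p (size (Node x y))" using p[of "Node x y"] by simp
      also have "\<dots> \<le> poly p (1 + size x + size (xs x))"
        using Cons.prems by (intro poly_nat_mono) simp
      finally show ?case
        using Cons.IH[of "?step x y a"] Cons.prems by (simp add: size_step)
    qed simp
    have "length us \<le> size (xs x)"
      using arg_cong[OF us, of length] length_list_of_tree_le[of "xs x"] by simp
    moreover have "\<forall>y\<in>set us. size y \<le> size (xs x)"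
      using arg_cong[OF us, of set] size_elem_list_of_tree[of _ "xs x"] by auto
    ultimately show "size (fold (?step x) us Leaf) \<le> b x"
      using le[of Leaf] mult_le_mono1[of "length us" "size (xs x)" "poly p (1 + size x + size (xs x))"]
      unfolding b_def by (metis (no_types, lifting) add_0 le_trans tree.size(3))
  qed (intro ptime_rev xs ptime_Leaf)+
  then show ?thesis using *[of _ _ "[]"] by simp
qed

lemma ptime_map:
  assumes "ptime xs" "ptime (\<lambda>z. f (left z) (right z))"
  shows "ptime (\<lambda>x. tree_of_list (map (f x) (list_of_tree (xs x))))"
  using ptime_concat_map[OF assms(1), of "\<lambda>x y. Node (f x y) Leaf"] assms(2)
  by (simp add: ptime_Node ptime_Leaf concat_map_singleton)

lemma ptime_filter:
  assumes "ptime xs" "ptest (\<lambda>z. P (left z) (right z))"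
  shows "ptime (\<lambda>x. tree_of_list (filter (P x) (list_of_tree (xs x))))"
proof -
  have "concat (map (\<lambda>y. list_of_tree (if Q y then Node y Leaf else Leaf)) ys) = filter Q ys"
    for Q and ys :: "tree list"
    by (induction ys) auto
  then show ?thesis
    using ptime_concat_map[OF assms(1), of "\<lambda>x y. if P x y then Node y Leaf else Leaf"] assms(2)
    by (simp add: ptime_if ptime_Node ptime_Leaf ptime_right ptime_id)
qed

text \<open>Nonemptiness of a filtered list. Below the quantifier the environment is the pair of the
  old environment and the bound variable, so nested quantifiers are reached through
  \<open>left\<close> and \<open>right\<close>.\<close>

lemma ptest_bex:
  assumes "ptime xs" "ptest (\<lambda>z. P (left z) (right z))"
  shows "ptest (\<lambda>x. \<exists>y\<in>set (list_of_tree (xs x)). P x y)"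
  using ptest_nonleaf[OF ptime_filter[OF assms]] by (simp add: filter_empty_conv)

lemma ptest_ball:
  assumes "ptime xs" "ptest (\<lambda>z. P (left z) (right z))"
  shows "ptest (\<lambda>x. \<forall>y\<in>set (list_of_tree (xs x)). P x y)"
  using ptest_not[OF ptest_bex[of xs "\<lambda>x y. \<not> P x y"]] assms by (simp add: ptest_not)

lemmas ptime_intros = ptime_id ptime_Leaf ptime_left ptime_right ptime_Node ptime_if
  ptime_append ptime_concat_map ptime_map ptime_filter ptest_nonleaf ptest_leaf ptest_not
  ptest_conj ptest_imp ptest_bex ptest_ball


section \<open>The algorithm\<close>

text \<open>Every tree denotes a number, its entries being ignored. Different trees may thus denote
  the same number, and comparisons always go through \<open>num\<close>.\<close>

definition num :: "tree \<Rightarrow> nat" where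
  "num t = length (list_of_tree t)"

lemma num_simps [simp]: "num Leaf = 0" "num (Node l r) = Suc (num r)"
  by (simp_all add: num_def)

lemma num_tree_of_nat [simp]: "num (tree_of_nat n) = n"
  by (simp add: num_def tree_of_nat_def)

lemma num_tree_of_list [simp]: "num (tree_of_list xs) = length xs"
  by (simp add: num_def)

definition tdrop :: "tree \<Rightarrow> tree \<Rightarrow> tree" where
  "tdrop m t = fold (\<lambda>_ t. right t) (list_of_tree m) t"

lemma list_of_tree_right: "list_of_tree (right t) = tl (list_of_tree t)"
  by (cases t) auto

lemma list_of_tree_tdrop: "list_of_tree (tdrop m t) = drop (num m) (list_of_tree t)"
proof -
  have "list_of_tree (fold (\<lambda>_ t. right t) us t) = drop (length us) (list_of_tree t)"
    for us :: "tree list"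
    by (induction us arbitrary: t) (auto simp: list_of_tree_right drop_Suc)
  then show ?thesis by (simp add: tdrop_def num_def)
qed

lemma ptime_tdrop:
  assumes "ptime f" "ptime g"
  shows "ptime (\<lambda>x. tdrop (f x) (g x))"
  unfolding tdrop_def
proof (rule ptime_fold[where b="\<lambda>x. size (g x)"])
  fix x and us vs :: "tree list"
  show "size (fold (\<lambda>_ t. right t) us (g x)) \<le> size (g x)"
  proof (induction us rule: rev_induct)
    case (snoc u us)
    then show ?case using size_right_le[of "fold (\<lambda>_ t. right t) us (g x)"] by simp
  qed simp
qed (intro assms ptime_size ptime_intros)+

definition tnth :: "tree \<Rightarrow> tree \<Rightarrow> tree" where
  "tnth t m = left (tdrop m t)"

lemma tnth_eq: "num m < num t \<Longrightarrow> tnth t m = list_of_tree t ! num m"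
proof -
  assume "num m < num t"
  then have "hd (list_of_tree (tdrop m t)) = list_of_tree t ! num m" "list_of_tree (tdrop m t) \<noteq> []"
    by (simp_all add: list_of_tree_tdrop num_def hd_drop_conv_nth del: list_of_tree_eq_Nil)
  then show ?thesis unfolding tnth_def by (cases "tdrop m t") auto
qed

lemma ptime_tnth: "ptime f \<Longrightarrow> ptime g \<Longrightarrow> ptime (\<lambda>x. tnth (f x) (g x))"
  unfolding tnth_def by (intro ptime_intros ptime_tdrop)

lemma ptest_num_eq:
  assumes "ptime f" "ptime g"
  shows "ptest (\<lambda>x. num (f x) = num (g x))"
proof -
  have "num a = num b \<longleftrightarrow> tdrop a b = Leaf \<and> tdrop b a = Leaf" for a b
    using list_of_tree_tdrop[of a b] list_of_tree_tdrop[of b a]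
    by (auto simp flip: list_of_tree_eq_Nil simp: num_def)
  then show ?thesis using assms by (simp only:) (intro ptime_intros ptime_tdrop)
qed

text \<open>The loop starts with the list of \<open>0\<close> alone and repeatedly puts the
  successor of the head in front, so the list is decreasing; \<open>right\<close> then removes
  \<open>num t\<close> itself. It supplies the range of quantifiers over positions.\<close>

definition tupto :: "tree \<Rightarrow> tree" where
  "tupto t = right (fold (\<lambda>_ a. Node (Node Leaf (left a)) a) (list_of_tree t) (Node Leaf Leaf))"

lemma fold_tupto:
  "fold (\<lambda>_ a. Node (Node Leaf (left a)) a) us (Node Leaf Leaf) =
    tree_of_list (map tree_of_nat (rev [0..<Suc (length us)]))" for us :: "tree list"
  by (induction us rule: rev_induct) (auto simp: tree_of_nat_def)

lemma list_of_tree_tupto: "list_of_tree (tupto t) = map tree_of_nat (rev [0..<num t])"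
  unfolding tupto_def fold_tupto by (simp add: num_def)

lemma size_tree_of_nat [simp]: "size (tree_of_nat n) = n"
  by (induction n) (auto simp: tree_of_nat_def)

lemma ptime_tupto:
  assumes "ptime f"
  shows "ptime (\<lambda>x. tupto (f x))"
  unfolding tupto_def
proof (rule ptime_right, rule ptime_fold[where b="\<lambda>x. (size (f x) + 1) + (size (f x) + 1) * size (f x)"])
  fix x us vs assume "list_of_tree (f x) = us @ vs"
  then have "length us \<le> size (f x)" using length_list_of_tree_le[of "f x"] by simp
  then show "size (fold (\<lambda>_ a. Node (Node Leaf (left a)) a) us (Node Leaf Leaf)) \<le>
      (size (f x) + 1) + (size (f x) + 1) * size (f x)"
    unfolding fold_tupto by (intro size_tree_of_list_le) auto
qed (intro assms ptime_size ptime_intros pbound_intros)+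

definition nums_eq :: "tree \<Rightarrow> tree \<Rightarrow> bool" where
  "nums_eq x y \<longleftrightarrow> num x = num y \<and>
     (\<forall>n\<in>set (list_of_tree (tupto x)). num (tnth x n) = num (tnth y n))"

lemma ball_tupto: "(\<forall>n\<in>set (list_of_tree (tupto t)). P n) \<longleftrightarrow> (\<forall>n<num t. P (tree_of_nat n))"
  by (auto simp: list_of_tree_tupto)

lemma nums_eq_iff: "nums_eq x y \<longleftrightarrow> map num (list_of_tree x) = map num (list_of_tree y)"
proof -
  have "nums_eq x y \<longleftrightarrow> num x = num y \<and>
      (\<forall>n<num x. num (list_of_tree x ! n) = num (list_of_tree y ! n))"
    unfolding nums_eq_def ball_tupto by (rule conj_cong) (simp_all add: tnth_eq)
  also have "\<dots> \<longleftrightarrow> map num (list_of_tree x) = map num (list_of_tree y)"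
    unfolding list_eq_iff_nth_eq length_map num_def[symmetric] by (metis num_def nth_map)
  finally show ?thesis .
qed

text \<open>Below the quantifier of \<open>nums_eq\<close> the functions occur as
  \<open>f (left z)\<close> and \<open>g (left z)\<close>; the two \<open>ptime_comp\<close>
  instances take care of this, here and in the lemmas of the same shape below.\<close>

lemma ptest_nums_eq:
  assumes "ptime f" "ptime g"
  shows "ptest (\<lambda>x. nums_eq (f x) (g x))"
  unfolding nums_eq_def
  by (intro assms ptime_intros ptest_num_eq ptime_tnth ptime_tupto
      ptime_comp[OF assms(1)] ptime_comp[OF assms(2)])

section \<open>The decision procedure on encoded samples\<close>

definition structs :: "tree \<Rightarrow> tree" where
  "structs d = tree_of_list (list_of_tree (left d) @ list_of_tree (right d))"

definition inits_of :: "tree \<Rightarrow> tree" where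
  "inits_of M = left (right (right M))"

definition states_of :: "tree \<Rightarrow> tree" where
  "states_of M = left (right (right (right M)))"

text \<open>A state is named by the positions of its structure and of itself in that structure.\<close>

definition state_of :: "tree \<Rightarrow> tree \<Rightarrow> tree" where
  "state_of d u = tnth (states_of (tnth (structs d) (left u))) (right u)"

definition label_of :: "tree \<Rightarrow> tree \<Rightarrow> tree" where
  "label_of d u = left (state_of d u)"

definition trans_of :: "tree \<Rightarrow> tree \<Rightarrow> tree" where
  "trans_of d u = left (right (right (state_of d u)))"

text \<open>Membership up to \<open>num\<close>: the shifted index in \<open>solve\<close> is a list
  of encoded structures followed by leaves, hence a different tree from the number stored in the
  relation.\<close>

definition in_rel :: "tree \<Rightarrow> tree \<Rightarrow> tree \<Rightarrow> bool" where
  "in_rel R u v \<longleftrightarrow> (\<exists>z\<in>set (list_of_tree R).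
     num (left (left z)) = num (left u) \<and> num (right (left z)) = num (right u) \<and>
     num (left (right z)) = num (left v) \<and> num (right (right z)) = num (right v))"

text \<open>
  The coalition of \<open>x\<close> and \<open>y\<close> consists of the agents that play their first action in both.
  Up to agents without a choice at the two states at hand, every coalition is of this form.
\<close>

definition agree_of :: "tree \<Rightarrow> tree \<Rightarrow> tree \<Rightarrow> tree \<Rightarrow> bool" where
  "agree_of x y p q \<longleftrightarrow> (\<forall>n\<in>set (list_of_tree (tupto x)).
     num (tnth x n) = num (Node Leaf Leaf) \<and> num (tnth y n) = num (Node Leaf Leaf) \<longrightarrow>
     num (tnth p n) = num (tnth q n))"

text \<open>\<open>x\<close> and \<open>y\<close> only determine the coalition, \<open>p\<close> and
  \<open>q\<close> carry its moves at \<open>u\<close> and at \<open>v\<close>, \<open>q'\<close>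
  completes the answer at \<open>v\<close>, and \<open>p'\<close> completes the original move at
  \<open>u\<close>. These are six quantifiers over lists that are part of the input, hence
  polynomially many cases.\<close>

definition sim_of :: "tree \<Rightarrow> tree \<Rightarrow> tree \<Rightarrow> tree \<Rightarrow> bool" where
  "sim_of d R u v \<longleftrightarrow>
     (\<forall>x\<in>set (list_of_tree (trans_of d u)). \<forall>y\<in>set (list_of_tree (trans_of d v)).
      \<forall>p\<in>set (list_of_tree (trans_of d u)). \<exists>q\<in>set (list_of_tree (trans_of d v)).
      \<forall>q'\<in>set (list_of_tree (trans_of d v)). agree_of (left x) (left y) (left q') (left q) \<longrightarrow>
       (\<exists>p'\<in>set (list_of_tree (trans_of d u)). agree_of (left x) (left y) (left p') (left p) \<and>
          in_rel R (Node (left u) (right p')) (Node (left v) (right q'))))"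

definition check :: "tree \<Rightarrow> tree \<Rightarrow> tree \<Rightarrow> bool" where
  "check d R z \<longleftrightarrow> nums_eq (label_of d (left z)) (label_of d (right z)) \<and>
     sim_of d R (left z) (right z) \<and> sim_of d R (right z) (left z)"

definition ids :: "tree \<Rightarrow> tree" where
  "ids d = tree_of_list (concat (map (\<lambda>i. list_of_tree
     (tree_of_list (map (\<lambda>j. Node i j) (list_of_tree (tupto (states_of (tnth (structs d) i)))))))
     (list_of_tree (tupto (structs d)))))"

definition id_pairs :: "tree \<Rightarrow> tree" where
  "id_pairs d = tree_of_list (concat (map (\<lambda>u. list_of_tree
     (tree_of_list (map (\<lambda>v. Node u v) (list_of_tree (ids d))))) (list_of_tree (ids d))))"

definition refine :: "tree \<Rightarrow> tree \<Rightarrow> tree" where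
  "refine d R = tree_of_list (filter (check d R) (list_of_tree R))"

text \<open>The list of pairs also serves as the round counter; \<open>refine_equiv_rel\<close>
  shows that so many rounds reach a fixed point.\<close>

definition equiv_rel :: "tree \<Rightarrow> tree" where
  "equiv_rel d = fold (\<lambda>_ R. refine d R) (list_of_tree (id_pairs d)) (id_pairs d)"

text \<open>The structures of \<open>N\<close> follow those of \<open>P\<close> in
  \<open>structs d\<close>, so the index of a negative structure is shifted by the number of
  positive ones, which in unary means appending lists. The first conjunct looks for a structure with
  a nonempty list of propositions.\<close>

definition solve :: "tree \<Rightarrow> bool" where
  "solve d \<longleftrightarrow> (\<exists>M\<in>set (list_of_tree (structs d)). left (right M) \<noteq> Leaf) \<and>
     (\<forall>i\<in>set (list_of_tree (tupto (right d))). \<exists>q\<in>set (list_of_tree (inits_of (tnth (right d) i))).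
      \<forall>j\<in>set (list_of_tree (tupto (left d))). \<forall>r\<in>set (list_of_tree (inits_of (tnth (left d) j))).
        \<not> in_rel (equiv_rel d)
          (Node (tree_of_list (list_of_tree (left d) @ list_of_tree i)) q) (Node j r))"

section \<open>Running time of the decision procedure\<close>

lemma ptime_structs: "ptime f \<Longrightarrow> ptime (\<lambda>x. structs (f x))"
  unfolding structs_def by (intro ptime_intros)

lemma ptime_inits_of: "ptime f \<Longrightarrow> ptime (\<lambda>x. inits_of (f x))"
  unfolding inits_of_def by (intro ptime_intros)

lemma ptime_states_of: "ptime f \<Longrightarrow> ptime (\<lambda>x. states_of (f x))"
  unfolding states_of_def by (intro ptime_intros)

lemma ptime_label_of: "ptime f \<Longrightarrow> ptime g \<Longrightarrow> ptime (\<lambda>x. label_of (f x) (g x))"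
  unfolding label_of_def state_of_def by (intro ptime_intros ptime_structs ptime_states_of ptime_tnth)

lemma ptime_trans_of: "ptime f \<Longrightarrow> ptime g \<Longrightarrow> ptime (\<lambda>x. trans_of (f x) (g x))"
  unfolding trans_of_def state_of_def by (intro ptime_intros ptime_structs ptime_states_of ptime_tnth)

lemma ptest_in_rel:
  assumes "ptime f" "ptime g" "ptime h"
  shows "ptest (\<lambda>x. in_rel (f x) (g x) (h x))"
  unfolding in_rel_def
  by (intro assms ptime_intros ptest_num_eq ptime_comp[OF assms(2)] ptime_comp[OF assms(3)])

lemma ptest_agree_of:
  assumes "ptime f" "ptime g" "ptime h" "ptime k"
  shows "ptest (\<lambda>x. agree_of (f x) (g x) (h x) (k x))"
  unfolding agree_of_def
  by (intro assms ptime_intros ptest_num_eq ptime_tnth ptime_tupto ptime_comp[OF assms(1)]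
      ptime_comp[OF assms(2)] ptime_comp[OF assms(3)] ptime_comp[OF assms(4)])

lemma ptest_sim_of:
  assumes "ptime f" "ptime g" "ptime h" "ptime k"
  shows "ptest (\<lambda>x. sim_of (f x) (g x) (h x) (k x))"
  unfolding sim_of_def
  by (intro assms ptime_intros ptime_trans_of ptest_agree_of ptest_in_rel ptime_comp[OF assms(1)]
      ptime_comp[OF assms(2)] ptime_comp[OF assms(3)] ptime_comp[OF assms(4)])

lemma ptest_check:
  assumes "ptime f" "ptime g" "ptime h"
  shows "ptest (\<lambda>x. check (f x) (g x) (h x))"
  unfolding check_def by (intro assms ptime_intros ptest_nums_eq ptime_label_of ptest_sim_of)

lemma ptime_id_pairs: "ptime id_pairs"
proof -
  have *: "ptime ids"
    unfolding ids_def by (intro ptime_intros ptime_tupto ptime_states_of ptime_tnth ptime_structs)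
  show ?thesis unfolding id_pairs_def by (intro ptime_intros ptime_comp[OF *])
qed

text \<open>Refinement only drops entries, so the initial list of pairs bounds the size of all later
  ones.\<close>

lemma ptime_equiv_rel: "ptime equiv_rel"
  unfolding equiv_rel_def
proof (rule ptime_fold[where b="\<lambda>x. size (id_pairs x)"])
  have "size (tree_of_list (filter P (list_of_tree t))) \<le> size t" for P and t
    by (induction t) auto
  then have *: "size (refine d R) \<le> size R" for d R unfolding refine_def .
  fix x and us vs :: "tree list"
  show "size (fold (\<lambda>_. refine x) (us :: tree list) (id_pairs x)) \<le> size (id_pairs x)"
  proof (induction us rule: rev_induct)
    case (snoc u us)
    then show ?case using *[of x "fold (\<lambda>_. refine x) us (id_pairs x)"] by simp
  qed simp
  show "ptime (\<lambda>z. refine (left z) (right (right z)))"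
    unfolding refine_def by (intro ptime_intros ptest_check)
qed (intro ptime_id_pairs ptime_size)+

lemma ptest_solve: "ptest solve"
  unfolding solve_def
  by (intro ptime_intros ptime_structs ptime_tupto ptime_inits_of ptime_tnth ptest_in_rel
      ptime_comp[OF ptime_equiv_rel])


section \<open>ATL equivalence and alternating bisimulation\<close>

text \<open>One round of alternating simulation: whatever \<open>A\<close> can enforce at
  \<open>q\<close> it can enforce at \<open>r\<close>. Moves of the coalition are represented by
  full tuples of which only the entries in \<open>A\<close> count, so that both coalition moves and
  their completions range over the tuples that are listed in the encoding.\<close>

definition game ::
    "nat set \<Rightarrow> ('q \<Rightarrow> 'q \<Rightarrow> bool) \<Rightarrow> ('q, 'p) cgs \<Rightarrow> 'q \<Rightarrow> ('q, 'p) cgs \<Rightarrow> 'q \<Rightarrow> bool" where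
  "game A R C q D r \<longleftrightarrow>
     (\<forall>\<alpha>\<in>act C (agents C) q. \<exists>\<beta>\<in>act D (agents D) r.
      \<forall>\<beta>'\<in>act D (agents D) r. (\<forall>a\<in>A. \<beta>' a = \<beta> a) \<longrightarrow>
       (\<exists>\<alpha>'\<in>act C (agents C) q. (\<forall>a\<in>A. \<alpha>' a = \<alpha> a) \<and> R (trans C q \<alpha>') (trans D r \<beta>')))"

text \<open>Inclusion is demanded on states only, because a relation on positions says something
  meaningful only about actual states.\<close>

lemma game_mono:
  assumes "game A R C q D r" and "cgs C" "q \<in> states C" "cgs D" "r \<in> states D"
    and "\<And>u v. u \<in> states C \<Longrightarrow> v \<in> states D \<Longrightarrow> R u v \<Longrightarrow> S u v"
  shows "game A S C q D r"
  unfolding game_def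
proof
  fix \<alpha> assume "\<alpha> \<in> act C (agents C) q"
  with assms(1) obtain \<beta> where \<beta>: "\<beta> \<in> act D (agents D) r"
    "\<And>\<beta>'. \<beta>' \<in> act D (agents D) r \<Longrightarrow> \<forall>a\<in>A. \<beta>' a = \<beta> a \<Longrightarrow>
      \<exists>\<alpha>'\<in>act C (agents C) q. (\<forall>a\<in>A. \<alpha>' a = \<alpha> a) \<and> R (trans C q \<alpha>') (trans D r \<beta>')"
    unfolding game_def by blast
  have "\<exists>\<alpha>'\<in>act C (agents C) q. (\<forall>a\<in>A. \<alpha>' a = \<alpha> a) \<and> S (trans C q \<alpha>') (trans D r \<beta>')"
    if "\<beta>' \<in> act D (agents D) r" "\<forall>a\<in>A. \<beta>' a = \<beta> a" for \<beta>'
  proof -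
    from \<beta>(2)[OF that] obtain \<alpha>' where \<alpha>': "\<alpha>' \<in> act C (agents C) q" "\<forall>a\<in>A. \<alpha>' a = \<alpha> a"
      "R (trans C q \<alpha>') (trans D r \<beta>')" by blast
    moreover have "trans C q \<alpha>' \<in> states C" "trans D r \<beta>' \<in> states D"
      using assms(2-5) \<alpha>'(1) that(1) unfolding cgs_def by blast+
    ultimately show ?thesis using assms(6) by blast
  qed
  then show "\<exists>\<beta>\<in>act D (agents D) r. \<forall>\<beta>'\<in>act D (agents D) r. (\<forall>a\<in>A. \<beta>' a = \<beta> a) \<longrightarrow>
      (\<exists>\<alpha>'\<in>act C (agents C) q. (\<forall>a\<in>A. \<alpha>' a = \<alpha> a) \<and> S (trans C q \<alpha>') (trans D r \<beta>'))"
    using \<beta>(1) by blast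
qed

text \<open>Passes from a partial tuple and its completion to full tuples that agree on
  \<open>A\<close>, the form used in \<open>game\<close>. As only the values of
  \<open>\<gamma>\<close> on \<open>A\<close> matter, it covers restricted strategy moves and full
  tuples alike.\<close>

lemma succs_eq:
  assumes "A \<subseteq> agents C" "\<alpha> \<in> act C (agents C) q" "\<And>a. a \<in> A \<Longrightarrow> \<gamma> a = \<alpha> a"
  shows "succs C A q \<gamma> = {trans C q \<alpha>' | \<alpha>'. \<alpha>' \<in> act C (agents C) q \<and> (\<forall>a\<in>A. \<alpha>' a = \<alpha> a)}"
proof (intro equalityI subsetI)
  fix u assume "u \<in> succs C A q \<gamma>"
  then obtain \<beta> where \<beta>: "\<beta> \<in> act C (agents C - A) q"
    "u = trans C q (\<lambda>a. if a \<in> A then \<gamma> a else \<beta> a)" by (auto simp: succs_def)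
  define \<alpha>' where "\<alpha>' = (\<lambda>a. if a \<in> A then \<gamma> a else \<beta> a)"
  have "\<alpha>' \<in> act C (agents C) q"
    unfolding act_def \<alpha>'_def
  proof (rule PiE_I)
    fix a assume a: "a \<in> agents C"
    show "(if a \<in> A then \<gamma> a else \<beta> a) \<in> {1..moves C q a}"
      using PiE_mem[OF assms(2)[unfolded act_def] a] PiE_mem[OF \<beta>(1)[unfolded act_def], of a]
        assms(3)[of a] a by (cases "a \<in> A") auto
  next
    fix a assume a: "a \<notin> agents C"
    show "(if a \<in> A then \<gamma> a else \<beta> a) = undefined"
      using PiE_arb[OF \<beta>(1)[unfolded act_def], of a] assms(1) a by auto
  qed
  moreover have "\<forall>a\<in>A. \<alpha>' a = \<alpha> a" using assms(3) unfolding \<alpha>'_def by simp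
  moreover have "u = trans C q \<alpha>'" using \<beta>(2) unfolding \<alpha>'_def .
  ultimately show "u \<in> {trans C q \<alpha>' | \<alpha>'. \<alpha>' \<in> act C (agents C) q \<and> (\<forall>a\<in>A. \<alpha>' a = \<alpha> a)}"
    by blast
next
  fix u assume "u \<in> {trans C q \<alpha>' | \<alpha>'. \<alpha>' \<in> act C (agents C) q \<and> (\<forall>a\<in>A. \<alpha>' a = \<alpha> a)}"
  then obtain \<alpha>' where \<alpha>': "\<alpha>' \<in> act C (agents C) q" "\<forall>a\<in>A. \<alpha>' a = \<alpha> a" "u = trans C q \<alpha>'"
    by blast
  let ?\<beta> = "restrict \<alpha>' (agents C - A)"
  have beta: "?\<beta> \<in> act C (agents C - A) q" using \<alpha>'(1) unfolding act_def by auto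
  have "(\<lambda>a. if a \<in> A then \<gamma> a else ?\<beta> a) = \<alpha>'"
  proof
    fix a
    show "(if a \<in> A then \<gamma> a else ?\<beta> a) = \<alpha>' a"
      using \<alpha>'(2) assms(3)[of a] PiE_arb[OF \<alpha>'(1)[unfolded act_def], of a] by auto
  qed
  then have *: "u = trans C q (\<lambda>a. if a \<in> A then \<gamma> a else ?\<beta> a)" using \<alpha>'(3) by (simp only:)
  show "u \<in> succs C A q \<gamma>" unfolding succs_def * using beta by blast
qed

text \<open>Action \<open>1\<close> is available to every agent at every state, so it can fill the
  entries outside the coalition.\<close>

definition completion :: "('q, 'p) cgs \<Rightarrow> nat set \<Rightarrow> (nat \<Rightarrow> nat) \<Rightarrow> nat \<Rightarrow> nat" where
  "completion C A \<gamma> = (\<lambda>a\<in>agents C. if a \<in> A then \<gamma> a else 1)"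

lemma completion_in_act:
  assumes "cgs C" "q \<in> states C" "\<And>a. a \<in> A \<Longrightarrow> 1 \<le> \<gamma> a \<and> \<gamma> a \<le> moves C q a"
  shows "completion C A \<gamma> \<in> act C (agents C) q"
  using assms unfolding cgs_def completion_def act_def by auto

lemma completion_eq: "A \<subseteq> agents C \<Longrightarrow> a \<in> A \<Longrightarrow> completion C A \<gamma> a = \<gamma> a"
  by (auto simp: completion_def)

section \<open>Bisimilar states satisfy the same formulas\<close>

text \<open>Since symmetry is built in, the remaining clauses are stated for one side only and hold
  for \<open>D\<close> and \<open>r\<close> as well.\<close>

definition alt_bisim ::
    "(('q, 'p) cgs \<Rightarrow> 'q \<Rightarrow> ('q, 'p) cgs \<Rightarrow> 'q \<Rightarrow> bool) \<Rightarrow> nat set \<Rightarrow> bool" where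
  "alt_bisim B Ag \<longleftrightarrow> (\<forall>C q D r. B C q D r \<longrightarrow>
     cgs C \<and> q \<in> states C \<and> agents C = Ag \<and> label C q = label D r \<and> B D r C q \<and>
     (\<forall>A\<subseteq>Ag. game A (\<lambda>u v. B C u D v) C q D r))"

text \<open>The new strategy simulates each history \<open>h\<close> in \<open>D\<close> by a
  history \<open>m h\<close> in \<open>C\<close>, asks \<open>s\<close> for its move there and plays
  an answer to that move in the game. The game guarantees that every successor reached in
  \<open>D\<close> is matched by a successor in \<open>C\<close> compatible with \<open>s\<close>,
  which extends the simulated history. So each outcome in \<open>D\<close> is accompanied by an
  outcome of \<open>s\<close>.\<close>

lemma outcome_transfer:
  assumes B: "alt_bisim B Ag" and init: "B C q D r" and A: "A \<subseteq> Ag"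
    and s: "\<And>a. a \<in> A \<Longrightarrow> strategy C a (s a)"
  shows "\<exists>s'. (\<forall>a\<in>A. strategy D a (s' a)) \<and>
    (\<forall>\<rho>'\<in>outcomes D A s' r. \<exists>\<rho>\<in>outcomes C A s q. \<forall>i. B C (\<rho> i) D (\<rho>' i))"
proof -
  have BD: "cgs C" "cgs D" "agents C = Ag" "agents D = Ag" "u \<in> states C" "v \<in> states D"
    "game A (\<lambda>u v. B C u D v) C u D v" if "B C u D v" for u v
    using B A that unfolding alt_bisim_def by blast+
  define \<alpha> where "\<alpha> = (\<lambda>g. completion C A (\<lambda>a. s a g))"
  have \<alpha>: "\<alpha> g \<in> act C (agents C) (last g)" if "g \<noteq> []" "set g \<subseteq> states C" for g
  proof -
    have "last g \<in> states C" using that last_in_set by blast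
    moreover have "1 \<le> s a g \<and> s a g \<le> moves C (last g) a" if "a \<in> A" for a
      using s[OF that] \<open>g \<noteq> []\<close> \<open>set g \<subseteq> states C\<close> unfolding strategy_def by blast
    ultimately show ?thesis
      unfolding \<alpha>_def using BD(1)[OF init] by (intro completion_in_act) auto
  qed
  have \<alpha>_eq: "\<alpha> g a = s a g" if "a \<in> A" for g a
    using completion_eq[of A C a] that A BD(3)[OF init] unfolding \<alpha>_def by blast
  \<comment> \<open>The extension of a simulated history \<open>g\<close> after the state
    \<open>v\<close> has been observed in \<open>D\<close>.\<close>
  define pick where "pick = (\<lambda>g v. SOME u. u \<in> succs C A (last g) (\<alpha> g) \<and> B C u D v)"
  \<comment> \<open>The recursion runs over the reversed history, as each extension depends on the
    last state and on the simulation of the earlier ones; the first state is always simulated by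
    \<open>q\<close>.\<close>
  define mm where "mm = rec_list [] (\<lambda>v h g. g @ [if h = [] then q else pick g v])"
  have mm_Cons: "mm (v # h) = mm h @ [if h = [] then q else pick (mm h) v]" and mm_Nil: "mm [] = []"
    for v h unfolding mm_def by simp_all
  define m where "m = (\<lambda>h. mm (rev h))"
  define P where "P = (\<lambda>h \<beta>. \<beta> \<in> act D (agents D) (last h) \<and>
     (\<forall>\<beta>'\<in>act D (agents D) (last h). (\<forall>a\<in>A. \<beta>' a = \<beta> a) \<longrightarrow>
       (\<exists>\<alpha>'\<in>act C (agents C) (last (m h)). (\<forall>a\<in>A. \<alpha>' a = \<alpha> (m h) a) \<and>
          B C (trans C (last (m h)) \<alpha>') D (trans D (last h) \<beta>'))))"
  define ok where "ok = (\<lambda>h. set (m h) \<subseteq> states C \<and> m h \<noteq> [] \<and> B C (last (m h)) D (last h))"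
  define \<beta> where "\<beta> = (\<lambda>h. SOME b. P h b)"
  have \<beta>: "P h (\<beta> h)" if "ok h" for h
  proof -
    have "game A (\<lambda>u v. B C u D v) C (last (m h)) D (last h)"
      using that BD(7) unfolding ok_def by blast
    then have "\<exists>b. P h b" using \<alpha>[of "m h"] that unfolding game_def P_def ok_def by blast
    then show ?thesis unfolding \<beta>_def by (rule someI_ex)
  qed
  \<comment> \<open>A strategy must also move on histories along which the simulation has failed.
    There the always available action \<open>1\<close> is played; the prefixes of outcomes all
    satisfy \<open>ok\<close>.\<close>
  define s' where "s' = (\<lambda>a h. if ok h then \<beta> h a else 1)"
  have strat: "strategy D a (s' a)" if "a \<in> A" for a
    unfolding strategy_def
  proof (intro allI impI)
    fix h :: "'a list" assume h: "h \<noteq> []" "set h \<subseteq> states D"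
    have "a \<in> agents D" using that A BD(4)[OF init] by blast
    moreover have "last h \<in> states D" using h by auto
    moreover have "cgs D" using BD(2)[OF init] .
    ultimately have "1 \<le> moves D (last h) a" unfolding cgs_def by blast
    moreover have "1 \<le> \<beta> h a \<and> \<beta> h a \<le> moves D (last h) a" if "ok h"
      using \<beta>[OF that] \<open>a \<in> agents D\<close> unfolding P_def act_def by auto
    ultimately show "1 \<le> s' a h \<and> s' a h \<le> moves D (last h) a" unfolding s'_def by auto
  qed
  moreover have "\<exists>\<rho>\<in>outcomes C A s q. \<forall>i. B C (\<rho> i) D (\<rho>' i)" if out: "\<rho>' \<in> outcomes D A s' r" for \<rho>'
  proof -
    let ?h = "\<lambda>i. map \<rho>' [0..<Suc i]"
    define \<rho> where "\<rho> = (\<lambda>i. last (m (?h i)))"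
    have m_Suc: "m (?h (Suc i)) = m (?h i) @ [pick (m (?h i)) (\<rho>' (Suc i))]" for i
      unfolding m_def by (simp add: mm_Cons)
    have \<rho>_Suc: "\<rho> (Suc i) = pick (m (?h i)) (\<rho>' (Suc i))" for i
      unfolding \<rho>_def m_Suc by simp
    have m_0: "m (?h 0) = [q]" unfolding m_def by (simp add: mm_Cons mm_Nil)
    have m_eq: "m (?h i) = map \<rho> [0..<Suc i]" for i
    proof (induction i)
      case 0
      then show ?case using m_0 by (simp add: \<rho>_def)
    next
      case (Suc i)
      have "m (?h (Suc i)) = map \<rho> [0..<Suc i] @ [\<rho> (Suc i)]"
        unfolding m_Suc \<rho>_Suc Suc.IH ..
      then show ?case by simp
    qed
    have r: "\<rho>' 0 = r" and step: "\<And>i. \<rho>' (Suc i) \<in> succs D A (\<rho>' i) (\<lambda>a\<in>A. s' a (?h i))"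
      using out unfolding outcomes_def by auto
    have next_state: "\<rho> (Suc i) \<in> succs C A (\<rho> i) (\<lambda>a\<in>A. s a (map \<rho> [0..<Suc i])) \<and>
        B C (\<rho> (Suc i)) D (\<rho>' (Suc i))" if "ok (?h i)" for i
    proof -
      let ?g = "m (?h i)"
      have last: "last (?h i) = \<rho>' i" "last ?g = \<rho> i" by (simp_all add: \<rho>_def)
      have "P (?h i) (\<beta> (?h i))" by (rule \<beta>[OF that])
      then have 1: "\<beta> (?h i) \<in> act D (agents D) (\<rho>' i)"
        and 2: "\<And>b. b \<in> act D (agents D) (\<rho>' i) \<Longrightarrow> \<forall>a\<in>A. b a = \<beta> (?h i) a \<Longrightarrow>
          \<exists>\<alpha>'\<in>act C (agents C) (\<rho> i). (\<forall>a\<in>A. \<alpha>' a = \<alpha> ?g a) \<and>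
            B C (trans C (\<rho> i) \<alpha>') D (trans D (\<rho>' i) b)"
        unfolding P_def last by blast+
      have "succs D A (\<rho>' i) (\<lambda>a\<in>A. s' a (?h i)) = {trans D (\<rho>' i) b | b.
          b \<in> act D (agents D) (\<rho>' i) \<and> (\<forall>a\<in>A. b a = \<beta> (?h i) a)}"
        using A BD(4)[OF init] that by (intro succs_eq 1) (auto simp: s'_def)
      then obtain b where b: "b \<in> act D (agents D) (\<rho>' i)" "\<forall>a\<in>A. b a = \<beta> (?h i) a"
        "\<rho>' (Suc i) = trans D (\<rho>' i) b" using step[of i] by auto
      obtain \<alpha>' where \<alpha>': "\<alpha>' \<in> act C (agents C) (\<rho> i)" "\<forall>a\<in>A. \<alpha>' a = \<alpha> ?g a"
        "B C (trans C (\<rho> i) \<alpha>') D (\<rho>' (Suc i))"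
        using 2[OF b(1,2)] b(3) by auto
      have act: "\<alpha> ?g \<in> act C (agents C) (\<rho> i)"
        using \<alpha>[of ?g] that last(2) unfolding ok_def by simp
      have succs: "succs C A (\<rho> i) \<gamma> = {trans C (\<rho> i) a' | a'.
          a' \<in> act C (agents C) (\<rho> i) \<and> (\<forall>a\<in>A. a' a = \<alpha> ?g a)}"
        if "\<And>a. a \<in> A \<Longrightarrow> \<gamma> a = \<alpha> ?g a" for \<gamma>
        using A BD(3)[OF init] by (intro succs_eq act that) auto
      have "trans C (\<rho> i) \<alpha>' \<in> succs C A (\<rho> i) (\<alpha> ?g)"
        unfolding succs[of "\<alpha> ?g", OF refl] using \<alpha>'(1,2) by blast
      then have "\<exists>u. u \<in> succs C A (last ?g) (\<alpha> ?g) \<and> B C u D (\<rho>' (Suc i))"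
        using \<alpha>'(3) last(2) by auto
      from someI_ex[OF this] have "\<rho> (Suc i) \<in> succs C A (\<rho> i) (\<alpha> ?g)"
        "B C (\<rho> (Suc i)) D (\<rho>' (Suc i))"
        unfolding \<rho>_Suc pick_def last by auto
      moreover have "succs C A (\<rho> i) (\<lambda>a\<in>A. s a (map \<rho> [0..<Suc i])) = succs C A (\<rho> i) (\<alpha> ?g)"
        using \<alpha>_eq m_eq by (subst (1 2) succs) auto
      ultimately show ?thesis by simp
    qed
    have ok: "ok (?h i)" for i
    proof (induction i)
      case 0
      then show ?case using init BD(5) r unfolding ok_def m_0 by auto
    next
      case (Suc i)
      have "B C (\<rho> (Suc i)) D (\<rho>' (Suc i))" using next_state[OF Suc] by blast
      moreover have "set (m (?h (Suc i))) \<subseteq> insert (\<rho> (Suc i)) (set (m (?h i)))"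
        unfolding m_Suc \<rho>_Suc by auto
      moreover have "m (?h (Suc i)) \<noteq> []" unfolding m_Suc by simp
      moreover have "last (m (?h (Suc i))) = \<rho> (Suc i)" by (simp only: \<rho>_def)
      moreover have "last (?h (Suc i)) = \<rho>' (Suc i)" by simp
      ultimately show ?case using Suc BD(5) unfolding ok_def by (simp only:) blast
    qed
    have "\<rho> 0 = q" unfolding \<rho>_def m_0 by simp
    then have "\<rho> \<in> outcomes C A s q"
      using next_state[OF ok] unfolding outcomes_def by blast
    moreover have "B C (\<rho> i) D (\<rho>' i)" for i
      using ok[of i] unfolding ok_def \<rho>_def by simp
    ultimately show ?thesis by blast
  qed
  ultimately show ?thesis by blast
qed

text \<open>For path formulas the induction compares pointwise related paths, so \<open>U\<close>
  and \<open>G\<close> reduce to the state formulas inside them. Only the coalition operator uses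
  the game, through \<open>outcome_transfer\<close>, and symmetry of \<open>B\<close> gives the
  other direction.\<close>

lemma alt_bisim_sat:
  assumes B: "alt_bisim B Ag"
  shows "atl_over AP Ag \<Phi> \<Longrightarrow> B C q D r \<Longrightarrow> sat C q \<Phi> = sat D r \<Phi>"
    and "path_over AP Ag \<phi> \<Longrightarrow> (\<And>i. B C (\<rho> i) D (\<rho>' i)) \<Longrightarrow> path_sat C \<rho> \<phi> = path_sat D \<rho>' \<phi>"
proof (induction \<Phi> and \<phi> arbitrary: C q D r and C \<rho> D \<rho>')
  case (Prop p)
  then show ?case using B unfolding alt_bisim_def by (metis sat.simps(1))
next
  case (Coal A \<phi>)
  have *: "sat D r (Coal A \<phi>)" if BCD: "B C q D r" and sat: "sat C q (Coal A \<phi>)" for C q D r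
  proof -
    have A: "A \<subseteq> Ag" using Coal.prems by simp
    obtain s where s: "\<And>a. a \<in> A \<Longrightarrow> strategy C a (s a)"
      "\<And>\<rho>. \<rho> \<in> outcomes C A s q \<Longrightarrow> path_sat C \<rho> \<phi>" using sat by auto
    obtain s' where s': "\<forall>a\<in>A. strategy D a (s' a)"
      "\<forall>\<rho>'\<in>outcomes D A s' r. \<exists>\<rho>\<in>outcomes C A s q. \<forall>i. B C (\<rho> i) D (\<rho>' i)"
      using outcome_transfer[OF B BCD A, of s] s(1) by blast
    have "path_sat D \<rho>' \<phi>" if \<rho>': "\<rho>' \<in> outcomes D A s' r" for \<rho>'
    proof -
      obtain \<rho> where \<rho>: "\<rho> \<in> outcomes C A s q" "\<forall>i. B C (\<rho> i) D (\<rho>' i)"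
        using bspec[OF s'(2) \<rho>'] by (rule bexE)
      have "path_over AP Ag \<phi>" using Coal.prems(1) by simp
      then have "path_sat C \<rho> \<phi> = path_sat D \<rho>' \<phi>" using \<rho>(2) by (intro Coal.IH) auto
      then show ?thesis using s(2)[OF \<rho>(1)] by simp
    qed
    then show ?thesis using s'(1) by auto
  qed
  have "B D r C q" using B Coal.prems(2) unfolding alt_bisim_def by blast
  then show ?case using * Coal.prems(2) by blast
next
  case (Neg \<Phi>)
  then show ?case by simp
next
  case (Conj \<Phi> \<Psi>)
  then show ?case by simp
next
  case (Next \<Phi>)
  then show ?case by simp
next
  case (Until \<Phi> \<Psi>)
  have "sat C (\<rho> i) \<Phi> = sat D (\<rho>' i) \<Phi>" "sat C (\<rho> i) \<Psi> = sat D (\<rho>' i) \<Psi>" for i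
    using Until.IH Until.prems by simp_all
  then show ?case by simp
next
  case (Always \<Phi>)
  have "sat C (\<rho> i) \<Phi> = sat D (\<rho>' i) \<Phi>" for i using Always.IH Always.prems by simp
  then show ?case by simp
qed

section \<open>Equivalent states are bisimilar\<close>

text \<open>The semantics of \<open>Next\<close> quantifies over infinite outcomes, so a successor
  allowed by the first move of the coalition only counts once it is known to lie on such an
  outcome.\<close>

lemma ex_outcome:
  assumes C: "cgs C" and q: "q \<in> states C" and A: "A \<subseteq> agents C"
    and s: "\<And>a. a \<in> A \<Longrightarrow> strategy C a (s a)"
    and \<alpha>: "\<alpha> \<in> act C (agents C) q" "\<And>a. a \<in> A \<Longrightarrow> \<alpha> a = s a [q]"
  shows "\<exists>\<rho>\<in>outcomes C A s q. \<rho> 1 = trans C q \<alpha>"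
proof -
  \<comment> \<open>The test \<open>h = [q]\<close> singles out the first move, since all later
    histories are longer; afterwards the opponents always play action \<open>1\<close>.\<close>
  define nxt where "nxt = (\<lambda>h. trans C (last h)
    (if h = [q] then \<alpha> else completion C A (\<lambda>a. s a h)))"
  define H where "H = rec_nat [q] (\<lambda>_ h. h @ [nxt h])"
  have H: "H 0 = [q]" "H (Suc i) = H i @ [nxt (H i)]" for i unfolding H_def by simp_all
  define \<rho> where "\<rho> = (\<lambda>i. last (H i))"
  have H_eq: "H i = map \<rho> [0..<Suc i]" for i
  proof (induction i)
    case (Suc i)
    have "H (Suc i) = map \<rho> [0..<Suc i] @ [\<rho> (Suc i)]" using Suc by (simp add: \<rho>_def H)
    then show ?case by simp
  qed (simp add: \<rho>_def H)
  have act: "(if H i = [q] then \<alpha> else completion C A (\<lambda>a. s a (H i))) \<in> act C (agents C) (\<rho> i)"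
    if "set (H i) \<subseteq> states C" for i
  proof (cases "H i = [q]")
    case True
    then show ?thesis using \<alpha>(1) by (simp add: \<rho>_def)
  next
    case False
    have "H i \<noteq> []" unfolding H_eq by simp
    then have "\<rho> i \<in> states C" using that last_in_set unfolding \<rho>_def by blast
    moreover have "1 \<le> s a (H i) \<and> s a (H i) \<le> moves C (\<rho> i) a" if "a \<in> A" for a
      using s[OF that] \<open>H i \<noteq> []\<close> \<open>set (H i) \<subseteq> states C\<close> unfolding strategy_def \<rho>_def by blast
    ultimately show ?thesis using False completion_in_act[OF C, of "\<rho> i" A "\<lambda>a. s a (H i)"] by simp
  qed
  have states: "set (H i) \<subseteq> states C" for i
  proof (induction i)
    case (Suc i)
    have "\<rho> i \<in> set (H i)" unfolding H_eq by simp
    then have "\<rho> i \<in> states C" using Suc by blast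
    then have "nxt (H i) \<in> states C"
      using C act[OF Suc] unfolding nxt_def cgs_def \<rho>_def by blast
    then show ?case using Suc by (simp add: H)
  qed (simp add: H q)
  have \<rho>_Suc: "\<rho> (Suc i) = trans C (\<rho> i) (if H i = [q] then \<alpha> else completion C A (\<lambda>a. s a (H i)))" for i
    unfolding \<rho>_def H nxt_def by simp
  have "\<rho> (Suc i) \<in> succs C A (\<rho> i) (\<lambda>a\<in>A. s a (map \<rho> [0..<Suc i]))" for i
  proof -
    let ?\<alpha> = "if H i = [q] then \<alpha> else completion C A (\<lambda>a. s a (H i))"
    have eq: "(\<lambda>a\<in>A. s a (map \<rho> [0..<Suc i])) a = ?\<alpha> a" if "a \<in> A" for a
      using that \<alpha>(2)[OF that] completion_eq[OF A that] unfolding H_eq[symmetric] by simp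
    have succs: "succs C A (\<rho> i) (\<lambda>a\<in>A. s a (map \<rho> [0..<Suc i])) = {trans C (\<rho> i) \<alpha>' | \<alpha>'.
        \<alpha>' \<in> act C (agents C) (\<rho> i) \<and> (\<forall>a\<in>A. \<alpha>' a = ?\<alpha> a)}"
      by (rule succs_eq[OF A act[OF states]]) (rule eq)
    show ?thesis
      unfolding \<rho>_Suc succs mem_Collect_eq
      by (rule exI[of _ ?\<alpha>], rule conjI[OF refl], rule conjI[OF act[OF states]]) blast
  qed
  moreover have "\<rho> 0 = q" by (simp add: \<rho>_def H)
  ultimately have "\<rho> \<in> outcomes C A s q" unfolding outcomes_def by blast
  moreover have "\<rho> 1 = trans C q \<alpha>" using \<rho>_Suc[of 0] \<open>\<rho> 0 = q\<close> by (simp add: H)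
  ultimately show ?thesis by blast
qed

text \<open>Only the first move of a strategy influences \<open>Next\<close>, so strategies can be
  traded for single action tuples.\<close>

lemma sat_Coal_Next_iff:
  assumes C: "cgs C" and q: "q \<in> states C" and A: "A \<subseteq> agents C"
  shows "sat C q (Coal A (Next \<Phi>)) \<longleftrightarrow> (\<exists>\<alpha>\<in>act C (agents C) q. \<forall>\<alpha>'\<in>act C (agents C) q.
    (\<forall>a\<in>A. \<alpha>' a = \<alpha> a) \<longrightarrow> sat C (trans C q \<alpha>') \<Phi>)" (is "_ \<longleftrightarrow> ?R")
proof
  assume "sat C q (Coal A (Next \<Phi>))"
  then obtain s where s: "\<And>a. a \<in> A \<Longrightarrow> strategy C a (s a)"
    "\<And>\<rho>. \<rho> \<in> outcomes C A s q \<Longrightarrow> sat C (\<rho> 1) \<Phi>" by auto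
  let ?\<alpha> = "completion C A (\<lambda>a. s a [q])"
  have "1 \<le> s a [q] \<and> s a [q] \<le> moves C q a" if "a \<in> A" for a
  proof -
    have "[q] \<noteq> []" "set [q] \<subseteq> states C" "last [q] = q" using q by auto
    then show ?thesis using s(1)[OF that] unfolding strategy_def by metis
  qed
  then have "?\<alpha> \<in> act C (agents C) q" by (intro completion_in_act C q)
  moreover have "sat C (trans C q \<alpha>') \<Phi>"
    if "\<alpha>' \<in> act C (agents C) q" "\<forall>a\<in>A. \<alpha>' a = ?\<alpha> a" for \<alpha>'
  proof -
    have "\<alpha>' a = s a [q]" if "a \<in> A" for a
      using \<open>\<forall>a\<in>A. \<alpha>' a = ?\<alpha> a\<close> that completion_eq[OF A that] by metis
    from ex_outcome[OF C q A s(1) \<open>\<alpha>' \<in> _\<close> this] show ?thesis using s(2) by metis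
  qed
  ultimately show ?R by blast
next
  assume ?R
  then obtain \<alpha> where \<alpha>: "\<alpha> \<in> act C (agents C) q"
    "\<And>\<alpha>'. \<alpha>' \<in> act C (agents C) q \<Longrightarrow> \<forall>a\<in>A. \<alpha>' a = \<alpha> a \<Longrightarrow> sat C (trans C q \<alpha>') \<Phi>" by blast
  \<comment> \<open>A memoryless strategy: it plays \<open>\<alpha>\<close> whenever the play is at
    \<open>q\<close>, where \<open>\<alpha>\<close> is legal, and the default action
    \<open>1\<close> elsewhere.\<close>
  define s where "s = (\<lambda>a h. if last h = q then \<alpha> a else 1)"
  have "strategy C a (s a)" if "a \<in> A" for a
    unfolding strategy_def
  proof (intro allI impI)
    fix h :: "'a list" assume h: "h \<noteq> []" "set h \<subseteq> states C"
    have a: "a \<in> agents C" using that A by blast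
    moreover have "last h \<in> states C" using h by auto
    ultimately have "1 \<le> moves C (last h) a" using C unfolding cgs_def by blast
    moreover have "1 \<le> \<alpha> a \<and> \<alpha> a \<le> moves C q a"
      using PiE_mem[OF \<alpha>(1)[unfolded act_def] a] by simp
    ultimately show "1 \<le> s a h \<and> s a h \<le> moves C (last h) a" unfolding s_def by auto
  qed
  moreover have "sat C (\<rho> 1) \<Phi>" if "\<rho> \<in> outcomes C A s q" for \<rho>
  proof -
    have \<rho>: "\<rho> 0 = q" "\<rho> (Suc 0) \<in> succs C A (\<rho> 0) (\<lambda>a\<in>A. s a (map \<rho> [0..<Suc 0]))"
      using that unfolding outcomes_def by blast+
    have eq: "(\<lambda>a\<in>A. s a (map \<rho> [0..<Suc 0])) a = \<alpha> a" if "a \<in> A" for a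
      using that \<rho>(1) by (simp add: s_def)
    have succs: "succs C A q (\<lambda>a\<in>A. s a (map \<rho> [0..<Suc 0])) =
        {trans C q \<alpha>' | \<alpha>'. \<alpha>' \<in> act C (agents C) q \<and> (\<forall>a\<in>A. \<alpha>' a = \<alpha> a)}"
      by (rule succs_eq[OF A \<alpha>(1)]) (rule eq)
    show ?thesis using \<rho>(2) \<alpha>(2) unfolding \<rho>(1) succs by auto
  qed
  ultimately show "sat C q (Coal A (Next \<Phi>))" by auto
qed

definition atl_equiv ::
    "'p set \<Rightarrow> nat set \<Rightarrow> ('q, 'p) cgs \<Rightarrow> 'q \<Rightarrow> ('q, 'p) cgs \<Rightarrow> 'q \<Rightarrow> bool" where
  "atl_equiv AP Ag C q D r \<longleftrightarrow> (\<forall>\<Phi>. atl_over AP Ag \<Phi> \<longrightarrow> sat C q \<Phi> = sat D r \<Phi>)"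

text \<open>The empty conjunction must be a tautology, and writing one down takes a proposition;
  hence the assumption on \<open>AP\<close>.\<close>

lemma ex_conj_formula:
  assumes "finite X" "AP \<noteq> {}" "\<And>x. x \<in> X \<Longrightarrow> atl_over AP Ag (\<Phi> x)"
  shows "\<exists>\<Psi>. atl_over AP Ag \<Psi> \<and>
    (\<forall>(C :: ('q, 'p) cgs) q. sat C q \<Psi> \<longleftrightarrow> (\<forall>x\<in>X. sat C q (\<Phi> x)))"
  using assms(1,3)
proof (induction X)
  case empty
  obtain p where "p \<in> AP" using assms(2) by blast
  then show ?case by (intro exI[of _ "Neg (Conj (Prop p) (Neg (Prop p)))"]) simp
next
  case (insert x X)
  then obtain \<Psi> where "atl_over AP Ag \<Psi>"
    "\<forall>(C :: ('q, 'p) cgs) q. sat C q \<Psi> \<longleftrightarrow> (\<forall>x\<in>X. sat C q (\<Phi> x))" by auto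
  then show ?case using insert.prems by (intro exI[of _ "Conj (\<Phi> x) \<Psi>"]) auto
qed

text \<open>A union of equivalence classes within a finite set is defined by a disjunction over its
  members of conjunctions that separate the member from all non-members. The disjunction is obtained
  as the negation of a conjunction of negated \<open>G u\<close>.\<close>

lemma ex_defining_formula:
  assumes U: "finite U" and AP: "AP \<noteq> {}"
    and X: "\<And>C q D r. (C, q) \<in> X \<Longrightarrow> (D, r) \<in> U \<Longrightarrow> atl_equiv AP Ag C q D r \<Longrightarrow> (D, r) \<in> X"
    and XU: "X \<subseteq> U"
  shows "\<exists>\<Psi>. atl_over AP Ag \<Psi> \<and> (\<forall>(C :: ('q, 'p) cgs, q)\<in>U. sat C q \<Psi> \<longleftrightarrow> (C, q) \<in> X)"
proof -
  have "\<exists>\<Phi>. atl_over AP Ag \<Phi> \<and> sat (fst u) (snd u) \<Phi> \<and> \<not> sat (fst v) (snd v) \<Phi>"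
    if u: "u \<in> X" and v: "v \<in> U - X" for u v
  proof -
    have "\<not> atl_equiv AP Ag (fst u) (snd u) (fst v) (snd v)"
      using X[of "fst u" "snd u" "fst v" "snd v"] u v by auto
    then obtain \<Phi> where "atl_over AP Ag \<Phi>" "sat (fst u) (snd u) \<Phi> \<noteq> sat (fst v) (snd v) \<Phi>"
      unfolding atl_equiv_def by blast
    \<comment> \<open>A distinguishing formula may hold on the wrong side, in which case its
      negation is taken.\<close>
    then show ?thesis by (cases "sat (fst u) (snd u) \<Phi>") (auto intro: exI[of _ \<Phi>] exI[of _ "Neg \<Phi>"])
  qed
  then obtain F where F: "\<And>u v. u \<in> X \<Longrightarrow> v \<in> U - X \<Longrightarrow> atl_over AP Ag (F u v)"
    "\<And>u v. u \<in> X \<Longrightarrow> v \<in> U - X \<Longrightarrow> sat (fst u) (snd u) (F u v)"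
    "\<And>u v. u \<in> X \<Longrightarrow> v \<in> U - X \<Longrightarrow> \<not> sat (fst v) (snd v) (F u v)"
    by metis
  have "\<exists>\<Psi>. atl_over AP Ag \<Psi> \<and>
      (\<forall>(C :: ('q, 'p) cgs) q. sat C q \<Psi> \<longleftrightarrow> (\<forall>v\<in>U - X. sat C q (F u v)))" if "u \<in> X" for u
    using U AP F(1)[OF that] by (intro ex_conj_formula) auto
  then obtain G where G: "\<And>u. u \<in> X \<Longrightarrow> atl_over AP Ag (G u)"
    "\<And>u (C :: ('q, 'p) cgs) q. u \<in> X \<Longrightarrow> sat C q (G u) \<longleftrightarrow> (\<forall>v\<in>U - X. sat C q (F u v))"
    by metis
  obtain \<Psi> where \<Psi>: "atl_over AP Ag \<Psi>"
    "\<forall>(C :: ('q, 'p) cgs) q. sat C q \<Psi> \<longleftrightarrow> (\<forall>u\<in>X. sat C q (Neg (G u)))"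
    using ex_conj_formula[OF finite_subset[OF XU U] AP, of Ag "\<lambda>u. Neg (G u)"] G(1) by auto
  have "sat C q (Neg \<Psi>) \<longleftrightarrow> (C, q) \<in> X" if "(C, q) \<in> U" for C :: "('q, 'p) cgs" and q
  proof -
    have "sat C q (Neg \<Psi>) \<longleftrightarrow> (\<exists>u\<in>X. \<forall>v\<in>U - X. sat C q (F u v))"
      using \<Psi>(2) G(2) by auto
    also have "\<dots> \<longleftrightarrow> (C, q) \<in> X"
    proof
      assume "\<exists>u\<in>X. \<forall>v\<in>U - X. sat C q (F u v)"
      then obtain u where u: "u \<in> X" "\<forall>v\<in>U - X. sat C q (F u v)" by blast
      show "(C, q) \<in> X"
      proof (rule ccontr)
        assume "(C, q) \<notin> X"
        then have "(C, q) \<in> U - X" using that by blast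
        then show False using F(3)[OF u(1)] u(2) by fastforce
      qed
    next
      assume X: "(C, q) \<in> X"
      have "sat C q (F (C, q) v)" if "v \<in> U - X" for v using F(2)[OF X that] by simp
      then show "\<exists>u\<in>X. \<forall>v\<in>U - X. sat C q (F u v)" using X by blast
    qed
    finally show ?thesis .
  qed
  then show ?thesis using \<Psi>(1) by (intro exI[of _ "Neg \<Psi>"]) auto
qed

text \<open>The Hennessy-Milner argument. Let \<open>\<Psi>\<close> define, within \<open>U\<close>,
  the states equivalent to some successor that \<open>\<alpha>\<close> allows. Then \<open>q\<close>
  satisfies \<open>Coal A (Next \<Psi>)\<close>, hence so does \<open>r\<close>, and a move that
  enforces \<open>\<Psi>\<close> at \<open>r\<close> is the required answer to
  \<open>\<alpha>\<close>.\<close>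

lemma game_atl_equiv:
  assumes U: "finite U" and AP: "AP \<noteq> {}" and A: "A \<subseteq> Ag"
    and C: "cgs C" "agents C = Ag" "q \<in> states C" "{C} \<times> states C \<subseteq> U"
    and D: "cgs D" "agents D = Ag" "r \<in> states D" "{D} \<times> states D \<subseteq> U"
    and eq: "atl_equiv AP Ag C q D r"
  shows "game A (\<lambda>u v. atl_equiv AP Ag C u D v) C q D r"
  unfolding game_def
proof
  fix \<alpha> assume \<alpha>: "\<alpha> \<in> act C (agents C) q"
  define X where "X = {(E, w) \<in> U. \<exists>\<alpha>'\<in>act C (agents C) q. (\<forall>a\<in>A. \<alpha>' a = \<alpha> a) \<and>
    atl_equiv AP Ag C (trans C q \<alpha>') E w}"
  have "\<exists>\<Psi>. atl_over AP Ag \<Psi> \<and> (\<forall>(E, w)\<in>U. sat E w \<Psi> \<longleftrightarrow> (E, w) \<in> X)"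
  proof (rule ex_defining_formula[OF U AP])
    fix E w F v
    assume E: "(E, w) \<in> X" and F: "(F, v) \<in> U" and eq: "atl_equiv AP Ag E w F v"
    from E obtain \<alpha>' where "\<alpha>'\<in>act C (agents C) q" "\<forall>a\<in>A. \<alpha>' a = \<alpha> a"
      "atl_equiv AP Ag C (trans C q \<alpha>') E w" unfolding X_def by blast
    moreover from this(3) eq have "atl_equiv AP Ag C (trans C q \<alpha>') F v"
      unfolding atl_equiv_def by simp
    ultimately show "(F, v) \<in> X" using F unfolding X_def by blast
  qed (auto simp: X_def)
  then obtain \<Psi> where \<Psi>: "atl_over AP Ag \<Psi>" "\<And>E w. (E, w) \<in> U \<Longrightarrow> sat E w \<Psi> \<longleftrightarrow> (E, w) \<in> X"
    by blast
  have "sat C (trans C q \<alpha>') \<Psi>" if "\<alpha>' \<in> act C (agents C) q" "\<forall>a\<in>A. \<alpha>' a = \<alpha> a" for \<alpha>'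
  proof -
    have "trans C q \<alpha>' \<in> states C" using C(1,3) that(1) unfolding cgs_def by blast
    then have U: "(C, trans C q \<alpha>') \<in> U" using C(4) by blast
    moreover have "atl_equiv AP Ag C (trans C q \<alpha>') C (trans C q \<alpha>')"
      unfolding atl_equiv_def by simp
    ultimately have "(C, trans C q \<alpha>') \<in> X" unfolding X_def using that by blast
    then show ?thesis using \<Psi>(2)[OF U] by simp
  qed
  then have "sat C q (Coal A (Next \<Psi>))"
    using sat_Coal_Next_iff[OF C(1,3), of A \<Psi>] A C(2) \<alpha> by blast
  moreover have "atl_over AP Ag (Coal A (Next \<Psi>))" using A \<Psi>(1) by simp
  ultimately have "sat D r (Coal A (Next \<Psi>))" using eq unfolding atl_equiv_def by blast
  then obtain \<beta> where \<beta>: "\<beta> \<in> act D (agents D) r"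
    "\<And>\<beta>'. \<beta>' \<in> act D (agents D) r \<Longrightarrow> \<forall>a\<in>A. \<beta>' a = \<beta> a \<Longrightarrow> sat D (trans D r \<beta>') \<Psi>"
    using sat_Coal_Next_iff[OF D(1,3), of A \<Psi>] A D(2) by blast
  have "\<exists>\<alpha>'\<in>act C (agents C) q. (\<forall>a\<in>A. \<alpha>' a = \<alpha> a) \<and>
      atl_equiv AP Ag C (trans C q \<alpha>') D (trans D r \<beta>')"
    if "\<beta>' \<in> act D (agents D) r" "\<forall>a\<in>A. \<beta>' a = \<beta> a" for \<beta>'
  proof -
    have "trans D r \<beta>' \<in> states D" using D(1,3) that(1) unfolding cgs_def by blast
    then have "(D, trans D r \<beta>') \<in> X" using \<Psi>(2) \<beta>(2)[OF that] D(4) by blast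
    then show ?thesis unfolding X_def by blast
  qed
  then show "\<exists>\<beta>\<in>act D (agents D) r. \<forall>\<beta>'\<in>act D (agents D) r. (\<forall>a\<in>A. \<beta>' a = \<beta> a) \<longrightarrow>
      (\<exists>\<alpha>'\<in>act C (agents C) q. (\<forall>a\<in>A. \<alpha>' a = \<alpha> a) \<and>
        atl_equiv AP Ag C (trans C q \<alpha>') D (trans D r \<beta>'))"
    using \<beta>(1) by blast
qed

section \<open>A criterion for the existence of a consistent formula\<close>

lemma label_eq_if_atl_equiv:
  assumes "atl_equiv AP Ag C q D r" "label C q \<subseteq> AP" "label D r \<subseteq> AP"
  shows "label C q = label D r"
proof -
  have "p \<in> label C q \<longleftrightarrow> p \<in> label D r" if "p \<in> AP" for p
    using assms(1) that unfolding atl_equiv_def by (auto dest: spec[of _ "Prop p"])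
  then show ?thesis using assms(2,3) by blast
qed

lemma atl_over_imp_props:
  "atl_over AP Ag \<Phi> \<Longrightarrow> AP \<noteq> {}" "path_over AP Ag \<phi> \<Longrightarrow> AP \<noteq> {}"
  by (induction \<Phi> and \<phi>) auto

text \<open>An initial state that refutes a consistent formula cannot be equivalent to an initial
  state of a positive structure, where the formula holds. Conversely, a formula defining the classes
  of the positive initial states accepts all of \<open>P\<close> and fails at the given state of
  each structure in \<open>N\<close>.\<close>

lemma ex_consistent_iff:
  assumes "sample (P, N)"
  defines "AP \<equiv> sample_props (P, N)" and "Ag \<equiv> sample_agents (P, N)"
  shows "(\<exists>\<Phi>. atl_over AP Ag \<Phi> \<and> consistent \<Phi> (P, N)) \<longleftrightarrow>
    AP \<noteq> {} \<and> (\<forall>C\<in>N. \<exists>q\<in>inits C. \<forall>D\<in>P. \<forall>r\<in>inits D. \<not> atl_equiv AP Ag C q D r)"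
proof
  assume "\<exists>\<Phi>. atl_over AP Ag \<Phi> \<and> consistent \<Phi> (P, N)"
  then obtain \<Phi> where \<Phi>: "atl_over AP Ag \<Phi>" "consistent \<Phi> (P, N)" by blast
  have "\<exists>q\<in>inits C. \<forall>D\<in>P. \<forall>r\<in>inits D. \<not> atl_equiv AP Ag C q D r" if C: "C \<in> N" for C
  proof -
    obtain q where q: "q \<in> inits C" "\<not> sat C q \<Phi>"
      using \<Phi>(2) C unfolding consistent_def models_def by auto
    have "\<not> atl_equiv AP Ag C q D r" if "D \<in> P" "r \<in> inits D" for D r
      using \<Phi> q(2) that unfolding consistent_def models_def atl_equiv_def by auto
    then show ?thesis using q(1) by blast
  qed
  then show "AP \<noteq> {} \<and> (\<forall>C\<in>N. \<exists>q\<in>inits C. \<forall>D\<in>P. \<forall>r\<in>inits D. \<not> atl_equiv AP Ag C q D r)"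
    using atl_over_imp_props(1)[OF \<Phi>(1)] by blast
next
  assume R: "AP \<noteq> {} \<and> (\<forall>C\<in>N. \<exists>q\<in>inits C. \<forall>D\<in>P. \<forall>r\<in>inits D. \<not> atl_equiv AP Ag C q D r)"
  \<comment> \<open>The formula has to be correct at initial states only, so no other states enter
    \<open>U\<close>.\<close>
  define U where "U = (SIGMA C:P \<union> N. inits C)"
  have "finite (inits C)" if "C \<in> P \<union> N" for C
    using assms(1) that finite_subset[of "inits C" "states C"] unfolding sample_def cgs_def by auto
  then have U: "finite U"
    using assms(1) unfolding U_def sample_def by auto
  define X where "X = {(E, w) \<in> U. \<exists>D\<in>P. \<exists>r\<in>inits D. atl_equiv AP Ag D r E w}"
  have "\<exists>\<Psi>. atl_over AP Ag \<Psi> \<and> (\<forall>(E, w)\<in>U. sat E w \<Psi> \<longleftrightarrow> (E, w) \<in> X)"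
  proof (rule ex_defining_formula[OF U])
    show "AP \<noteq> {}" using R by blast
    fix E w F v
    assume E: "(E, w) \<in> X" and F: "(F, v) \<in> U" and eq: "atl_equiv AP Ag E w F v"
    from E obtain D r where "D \<in> P" "r \<in> inits D" "atl_equiv AP Ag D r E w" unfolding X_def by blast
    moreover from this(3) eq have "atl_equiv AP Ag D r F v" unfolding atl_equiv_def by simp
    ultimately show "(F, v) \<in> X" using F unfolding X_def by blast
  qed (auto simp: X_def)
  then obtain \<Psi> where \<Psi>: "atl_over AP Ag \<Psi>" "\<And>E w. (E, w) \<in> U \<Longrightarrow> sat E w \<Psi> \<longleftrightarrow> (E, w) \<in> X"
    by blast
  have "sat C q \<Psi>" if "C \<in> P" "q \<in> inits C" for C q
  proof -
    have "(C, q) \<in> U" using that unfolding U_def by blast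
    moreover have "atl_equiv AP Ag C q C q" unfolding atl_equiv_def by simp
    ultimately have "(C, q) \<in> X" unfolding X_def using that by blast
    then show ?thesis using \<Psi>(2) \<open>(C, q) \<in> U\<close> by blast
  qed
  moreover have "\<exists>q\<in>inits C. \<not> sat C q \<Psi>" if C: "C \<in> N" for C
  proof -
    obtain q where q: "q \<in> inits C" "\<And>D r. D \<in> P \<Longrightarrow> r \<in> inits D \<Longrightarrow> \<not> atl_equiv AP Ag C q D r"
      using R C by blast
    have "\<not> atl_equiv AP Ag D r C q" if "D \<in> P" "r \<in> inits D" for D r
      using q(2)[OF that] unfolding atl_equiv_def by blast
    then have "(C, q) \<notin> X" unfolding X_def by blast
    moreover have "(C, q) \<in> U" using q(1) that unfolding U_def by blast
    ultimately show ?thesis using \<Psi>(2) q(1) by blast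
  qed
  ultimately have "consistent \<Psi> (P, N)" unfolding consistent_def models_def by simp
  then show "\<exists>\<Phi>. atl_over AP Ag \<Phi> \<and> consistent \<Phi> (P, N)" using \<Psi>(1) by blast
qed


section \<open>Correctness on encoded samples\<close>

text \<open>
  An agent without a choice at either state may be added to a coalition. So it suffices to consider
  the polynomially many coalitions that are read off from a pair of action tuples.
\<close>

lemma game_all_coalitions_iff:
  fixes C D :: "('q, 'p) cgs"
  assumes "cgs C" "agents C = Ag" "q \<in> states C" "cgs D" "agents D = Ag" "r \<in> states D"
  shows "(\<forall>A\<subseteq>Ag. game A R C q D r) \<longleftrightarrow>
    (\<forall>x\<in>act C Ag q. \<forall>y\<in>act D Ag r. game {a \<in> Ag. x a = 1 \<and> y a = 1} R C q D r)"
proof (intro iffI allI impI)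
  assume G: "\<forall>x\<in>act C Ag q. \<forall>y\<in>act D Ag r. game {a \<in> Ag. x a = 1 \<and> y a = 1} R C q D r"
  fix A assume A: "A \<subseteq> Ag"
  \<comment> \<open>Agents outside \<open>A\<close> play \<open>2\<close> where they have a second
    action, so that they drop out of the coalition read off from the two tuples; those with a single
    action at both states cannot avoid being added.\<close>
  define pick where "pick = (\<lambda>(E :: ('q, 'p) cgs) w. \<lambda>a\<in>Ag. if a \<in> A \<or> moves E w a = 1 then 1 else (2 :: nat))"
  have pick: "pick E w \<in> act E Ag w" if "cgs E" "agents E = Ag" "w \<in> states E" for E w
  proof -
    have "moves E w a \<ge> 1" if "a \<in> Ag" for a
      using that \<open>cgs E\<close> \<open>agents E = Ag\<close> \<open>w \<in> states E\<close> unfolding cgs_def by blast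
    then show ?thesis unfolding pick_def act_def by fastforce
  qed
  define A' where "A' = {a \<in> Ag. pick C q a = 1 \<and> pick D r a = 1}"
  have A': "a \<in> A' \<longleftrightarrow> a \<in> A \<or> a \<in> Ag \<and> moves C q a = 1 \<and> moves D r a = 1" for a
    using A unfolding A'_def pick_def by auto
  have "game A' R C q D r"
    using G pick[OF assms(1-3)] pick[OF assms(4-6)] unfolding A'_def by blast
  then show "game A R C q D r"
    unfolding game_def assms(2,5)
  proof (intro ballI)
    fix \<alpha> assume \<alpha>: "\<alpha> \<in> act C Ag q" and
      g: "\<forall>\<alpha>\<in>act C Ag q. \<exists>\<beta>\<in>act D Ag r. \<forall>\<beta>'\<in>act D Ag r. (\<forall>a\<in>A'. \<beta>' a = \<beta> a) \<longrightarrow>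
        (\<exists>\<alpha>'\<in>act C Ag q. (\<forall>a\<in>A'. \<alpha>' a = \<alpha> a) \<and> R (trans C q \<alpha>') (trans D r \<beta>'))"
    obtain \<beta> where \<beta>: "\<beta> \<in> act D Ag r" "\<And>\<beta>'. \<beta>' \<in> act D Ag r \<Longrightarrow> \<forall>a\<in>A'. \<beta>' a = \<beta> a \<Longrightarrow>
        \<exists>\<alpha>'\<in>act C Ag q. (\<forall>a\<in>A'. \<alpha>' a = \<alpha> a) \<and> R (trans C q \<alpha>') (trans D r \<beta>')"
      using bspec[OF g \<alpha>] by blast
    have "\<exists>\<alpha>'\<in>act C Ag q. (\<forall>a\<in>A. \<alpha>' a = \<alpha> a) \<and> R (trans C q \<alpha>') (trans D r \<beta>')"
      if \<beta>': "\<beta>' \<in> act D Ag r" "\<forall>a\<in>A. \<beta>' a = \<beta> a" for \<beta>'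
    proof -
      \<comment> \<open>An agent of \<open>A'\<close> outside \<open>A\<close> has a single action
        at \<open>r\<close>, so the two tuples agree on it without further assumption.\<close>
      have "\<beta>' a = \<beta> a" if "a \<in> A'" for a
      proof (cases "a \<in> A")
        case False
        then have "a \<in> Ag" "moves D r a = 1" using that A' by auto
        then show ?thesis
          using PiE_mem[OF \<beta>(1)[unfolded act_def], of a] PiE_mem[OF \<beta>'(1)[unfolded act_def], of a]
          by simp
      qed (use \<beta>'(2) in blast)
      then obtain \<alpha>' where "\<alpha>' \<in> act C Ag q" "\<forall>a\<in>A'. \<alpha>' a = \<alpha> a" "R (trans C q \<alpha>') (trans D r \<beta>')"
        using \<beta>(2)[OF \<beta>'(1)] by blast
      then show ?thesis using A' by blast
    qed
    then show "\<exists>\<beta>\<in>act D Ag r. \<forall>\<beta>'\<in>act D Ag r. (\<forall>a\<in>A. \<beta>' a = \<beta> a) \<longrightarrow>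
        (\<exists>\<alpha>'\<in>act C Ag q. (\<forall>a\<in>A. \<alpha>' a = \<alpha> a) \<and> R (trans C q \<alpha>') (trans D r \<beta>'))"
      using \<beta>(1) by blast
  qed
next
  assume G: "\<forall>A\<subseteq>Ag. game A R C q D r"
  show "\<forall>x\<in>act C Ag q. \<forall>y\<in>act D Ag r. game {a \<in> Ag. x a = 1 \<and> y a = 1} R C q D r"
    by (intro ballI G[rule_format]) auto
qed

section \<open>Decoding of sublists and action tuples\<close>

lemma position_less: "x \<in> set xs \<Longrightarrow> position xs x < length xs"
  by (induction xs) (auto simp: position_def)

lemma nth_position: "x \<in> set xs \<Longrightarrow> xs ! position xs x = x"
  by (induction xs) (auto simp: position_def)

lemma inj_on_position: "inj_on (position xs) (set xs)"
  by (metis inj_onI nth_position)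

lemma set_list_of_tree_sublist:
  "set (list_of_tree (tree_of_sublist xs A)) = (\<lambda>x. tree_of_nat (position xs x)) ` (set xs \<inter> A)"
  by (auto simp: tree_of_sublist_def)

text \<open>Subsets are listed in the order of one common enumeration, so equal sets have equal
  codes and entrywise comparison decides equality, even between labels of different
  structures.\<close>

lemma nums_eq_sublist:
  assumes "A \<subseteq> set xs" "B \<subseteq> set xs"
  shows "nums_eq (tree_of_sublist xs A) (tree_of_sublist xs B) \<longleftrightarrow> A = B"
proof
  assume "nums_eq (tree_of_sublist xs A) (tree_of_sublist xs B)"
  then have "map (position xs) (filter (\<lambda>x. x \<in> A) xs) = map (position xs) (filter (\<lambda>x. x \<in> B) xs)"
    unfolding nums_eq_iff tree_of_sublist_def by (simp add: comp_def)
  from arg_cong[OF this, of set]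
  have "position xs ` (set xs \<inter> A) = position xs ` (set xs \<inter> B)"
    by (simp add: Int_def)
  then have "set xs \<inter> A = set xs \<inter> B"
    using inj_on_image_eq_iff[OF inj_on_position, of "set xs \<inter> A" xs "set xs \<inter> B"] by simp
  then show "A = B" using assms by blast
qed (simp add: nums_eq_iff)

definition tree_of_tuple :: "nat \<Rightarrow> (nat \<Rightarrow> nat) \<Rightarrow> tree" where
  "tree_of_tuple k \<alpha> = tree_of_list (map (\<lambda>a. tree_of_nat (\<alpha> a)) [1..<Suc k])"

lemma agree_of_tuples:
  "agree_of (tree_of_tuple k x) (tree_of_tuple k y) (tree_of_tuple k p) (tree_of_tuple k q) \<longleftrightarrow>
    (\<forall>a\<in>{a \<in> {1..k}. x a = 1 \<and> y a = 1}. p a = q a)"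
proof -
  \<comment> \<open>Agents are counted from \<open>1\<close> and positions from \<open>0\<close>,
    hence \<open>Suc n\<close>.\<close>
  have nth: "num (tnth (tree_of_tuple k \<alpha>) (tree_of_nat n)) = \<alpha> (Suc n)" if "n < k" for \<alpha> n
    using that by (simp add: tnth_eq tree_of_tuple_def del: upt_Suc)
  have "num (tree_of_tuple k x) = k" by (simp add: tree_of_tuple_def)
  then have "agree_of (tree_of_tuple k x) (tree_of_tuple k y) (tree_of_tuple k p) (tree_of_tuple k q)
      \<longleftrightarrow> (\<forall>n<k. x (Suc n) = 1 \<and> y (Suc n) = 1 \<longrightarrow> p (Suc n) = q (Suc n))"
    unfolding agree_of_def ball_tupto by (simp add: nth)
  also have "\<dots> \<longleftrightarrow> (\<forall>a\<in>Suc ` {..<k}. x a = 1 \<and> y a = 1 \<longrightarrow> p a = q a)" by auto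
  also have "Suc ` {..<k} = {1..k}" by (auto simp: image_Suc_lessThan)
  finally show ?thesis by auto
qed

lemma act_of_list_map:
  assumes "\<alpha> \<in> act C (agents C) q"
  shows "act_of_list C (map \<alpha> [1..<Suc (num_agents C)]) = \<alpha>"
proof
  fix a
  show "act_of_list C (map \<alpha> [1..<Suc (num_agents C)]) a = \<alpha> a"
  proof (cases "a \<in> agents C")
    case True
    then show ?thesis by (auto simp: act_of_list_def agents_def simp del: upt_Suc)
  next
    case False
    then show ?thesis
      using PiE_arb[OF assms[unfolded act_def] False] by (simp add: act_of_list_def)
  qed
qed

lemma set_act_lists:
  "set (act_lists C q) = (\<lambda>\<alpha>. map \<alpha> [1..<Suc (num_agents C)]) ` act C (agents C) q"
proof (intro equalityI subsetI)
  let ?k = "num_agents C"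
  fix \<alpha>s assume "\<alpha>s \<in> set (act_lists C q)"
  then have len: "length \<alpha>s = ?k" and mem: "\<And>n. n < ?k \<Longrightarrow> \<alpha>s ! n \<in> {1..moves C q (Suc n)}"
    unfolding act_lists_def product_lists_set
    by (auto simp: list_all2_conv_all_nth simp del: upt_Suc)
  have "\<alpha>s = map (act_of_list C \<alpha>s) [1..<Suc ?k]"
    by (rule nth_equalityI) (auto simp: len act_of_list_def agents_def simp del: upt_Suc)
  moreover have "act_of_list C \<alpha>s \<in> act C (agents C) q"
    unfolding act_def act_of_list_def restrict_PiE_iff
  proof
    fix a assume "a \<in> agents C"
    then show "\<alpha>s ! (a - 1) \<in> {1..moves C q a}"
      using mem[of "a - 1"] by (auto simp: agents_def)
  qed
  ultimately show "\<alpha>s \<in> (\<lambda>\<alpha>. map \<alpha> [1..<Suc ?k]) ` act C (agents C) q" by blast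
next
  let ?k = "num_agents C"
  fix \<alpha>s assume "\<alpha>s \<in> (\<lambda>\<alpha>. map \<alpha> [1..<Suc ?k]) ` act C (agents C) q"
  then obtain \<alpha> where \<alpha>: "\<alpha> \<in> act C (agents C) q" "\<alpha>s = map \<alpha> [1..<Suc ?k]" by blast
  have "\<alpha> (Suc n) \<in> {1..moves C q (Suc n)}" if "n < ?k" for n
    using PiE_mem[OF \<alpha>(1)[unfolded act_def], of "Suc n"] that by (auto simp: agents_def)
  then show "\<alpha>s \<in> set (act_lists C q)"
    unfolding act_lists_def product_lists_set \<alpha>(2)
    by (auto simp: list_all2_conv_all_nth less_Suc_eq_le simp del: upt_Suc)
qed

text \<open>A round either changes nothing or shortens the list. After as many rounds as there were
  pairs, a fixed point has been reached or the list is empty, and the empty list is a fixed point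
  too.\<close>

lemma refine_equiv_rel: "refine d (equiv_rel d) = equiv_rel d"
proof -
  have len: "refine d R = R \<or> num (refine d R) < num R" for R
  proof (cases "\<forall>z\<in>set (list_of_tree R). check d R z")
    case True
    then show ?thesis by (simp add: refine_def filter_True)
  next
    case False
    then show ?thesis
      unfolding refine_def num_tree_of_list num_def[of R] by (auto intro: length_filter_less)
  qed
  have "refine d (fold (\<lambda>_. refine d) us R) = fold (\<lambda>_. refine d) us R \<or>
      num (fold (\<lambda>_. refine d) us R) + length us \<le> num R" for us :: "tree list" and R
  proof (induction us rule: rev_induct)
    case (snoc u us)
    then show ?case using len[of "fold (\<lambda>_. refine d) us R"] by auto
  qed simp
  from this[of "list_of_tree (id_pairs d)" "id_pairs d"]
  have "refine d (equiv_rel d) = equiv_rel d \<or> num (equiv_rel d) = 0"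
    unfolding equiv_rel_def num_def by auto
  moreover have "num R = 0 \<Longrightarrow> refine d R = R" for R by (cases R) (auto simp: refine_def)
  ultimately show ?thesis by blast
qed

section \<open>Correctness for an arbitrary fixed encoding\<close>

locale coded_sample =
  fixes P N :: "('q, 'p) cgs set" and ps :: "'p list" and Cs Ds :: "('q, 'p) cgs list"
    and qs :: "('q, 'p) cgs \<Rightarrow> 'q list" and d :: tree
  assumes sample: "sample (P, N)"
    and ps: "enumerates ps (sample_props (P, N))"
    and Cs: "enumerates Cs P" and Ds: "enumerates Ds N"
    and qs: "C \<in> P \<union> N \<Longrightarrow> enumerates (qs C) (states C)"
    and d: "d = Node (tree_of_list (map (\<lambda>C. tree_of_cgs ps (qs C) C) Cs))
                     (tree_of_list (map (\<lambda>C. tree_of_cgs ps (qs C) C) Ds))"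
begin

abbreviation "AP \<equiv> sample_props (P, N)"
abbreviation "Ag \<equiv> sample_agents (P, N)"
abbreviation "Ms \<equiv> Cs @ Ds"

lemma set_Ms: "set Ms = P \<union> N"
  using Cs Ds by (simp add: enumerates_def)

lemma structs_d: "structs d = tree_of_list (map (\<lambda>C. tree_of_cgs ps (qs C) C) Ms)"
  by (simp add: structs_def d)

lemma cgs: "C \<in> P \<union> N \<Longrightarrow> cgs C"
  using sample by (auto simp: sample_def)

lemma agents: "C \<in> P \<union> N \<Longrightarrow> agents C = Ag"
proof -
  assume C: "C \<in> P \<union> N"
  have "\<forall>C\<in>P \<union> N. \<forall>D\<in>P \<union> N. agents C = agents D"
    using sample unfolding sample_def by blast
  then have "(\<Union>D\<in>P \<union> N. agents D) = (\<Union>D\<in>P \<union> N. agents C)" using C by (intro SUP_cong) blast+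
  then show ?thesis unfolding sample_agents_def prod.case using C by blast
qed

lemma props: "C \<in> P \<union> N \<Longrightarrow> props C \<subseteq> set ps"
  using ps by (auto simp: enumerates_def sample_props_def)

lemma set_qs: "C \<in> P \<union> N \<Longrightarrow> set (qs C) = states C"
  using qs by (simp add: enumerates_def)

text \<open>A relation rather than a decoding function: trees out of range name nothing, and a state
  has many names because only \<open>num\<close> matters.\<close>

definition names :: "tree \<Rightarrow> ('q, 'p) cgs \<Rightarrow> 'q \<Rightarrow> bool" where
  "names u C q \<longleftrightarrow> num (left u) < length Ms \<and> C = Ms ! num (left u) \<and>
     num (right u) < length (qs C) \<and> q = qs C ! num (right u)"

lemma namesD:
  assumes "names u C q"
  shows "C \<in> P \<union> N" "q \<in> states C"
proof -
  show C: "C \<in> P \<union> N" using assms nth_mem set_Ms unfolding names_def by metis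
  show "q \<in> states C" using assms nth_mem set_qs[OF C] unfolding names_def by metis
qed

lemma names_cong:
  "num (left u) = num (left v) \<Longrightarrow> num (right u) = num (right v) \<Longrightarrow> names u C q = names v C q"
  by (simp add: names_def)

lemma names_target:
  assumes "names u C q" "q' \<in> states C"
  shows "names (Node (left u) (tree_of_nat (position (qs C) q'))) C q'"
  using assms position_less[of q' "qs C"] nth_position[of q' "qs C"] set_qs[OF namesD(1)[OF assms(1)]]
  by (auto simp: names_def)

lemma state_of_names:
  assumes "names u C q"
  shows "state_of d u = tree_of_state ps (qs C) C q"
proof -
  have "tnth (structs d) (left u) = tree_of_cgs ps (qs C) C"
    using assms by (simp add: names_def structs_d tnth_eq del: map_append)
  moreover have "num (right u) < length (qs C)" "q = qs C ! num (right u)"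
    using assms unfolding names_def by blast+
  ultimately show ?thesis by (simp add: state_of_def states_of_def tree_of_cgs_def tnth_eq)
qed

lemma label_of_names: "names u C q \<Longrightarrow> label_of d u = tree_of_sublist ps (label C q)"
  by (simp add: label_of_def state_of_names tree_of_state_def)

lemma set_trans_of_names:
  assumes "names u C q"
  shows "set (list_of_tree (trans_of d u)) = (\<lambda>\<alpha>. Node (tree_of_tuple (num_agents C) \<alpha>)
    (tree_of_nat (position (qs C) (trans C q \<alpha>)))) ` act C Ag q"
proof -
  have Ag: "Ag = agents C" using agents[OF namesD(1)[OF assms]] by simp
  show ?thesis
    unfolding trans_of_def state_of_names[OF assms] tree_of_state_def tree_of_tuple_def Ag
    by (simp add: set_act_lists image_image comp_def act_of_list_map cong: image_cong
        del: upt_Suc One_nat_def)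
qed

text \<open>A transition stores the position of its target only; the structure is taken over from
  the name of the source.\<close>

definition target_rel :: "tree \<Rightarrow> tree \<Rightarrow> ('q, 'p) cgs \<Rightarrow> tree \<Rightarrow> ('q, 'p) cgs \<Rightarrow> 'q \<Rightarrow> 'q \<Rightarrow> bool" where
  "target_rel R u C v D q r \<longleftrightarrow> in_rel R (Node (left u) (tree_of_nat (position (qs C) q)))
     (Node (left v) (tree_of_nat (position (qs D) r)))"

lemma sim_of_names:
  assumes "names u C q" "names v D r"
  shows "sim_of d R u v \<longleftrightarrow> (\<forall>A\<subseteq>Ag. game A (target_rel R u C v D) C q D r)"
proof -
  note CD = cgs[OF namesD(1)] agents[OF namesD(1)] namesD(2)
  have "num_agents C = num_agents D"
    using CD(2)[OF assms(1)] CD(2)[OF assms(2)] by (metis agents_def card_atLeastAtMost diff_Suc_1)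
  moreover have Ag: "{1..num_agents D} = Ag" using CD(2)[OF assms(2)] by (simp add: agents_def)
  \<comment> \<open>Both structures have the same number of agents, but it occurs under either name
    in the tuples of \<open>p\<close> and \<open>q\<close>; hence the disjunction.\<close>
  ultimately have agree: "agree_of (tree_of_tuple (num_agents C) x) (tree_of_tuple (num_agents D) y)
      (tree_of_tuple k p) (tree_of_tuple k q) \<longleftrightarrow> (\<forall>a\<in>{a \<in> Ag. x a = 1 \<and> y a = 1}. p a = q a)"
    if "k = num_agents C \<or> k = num_agents D" for x y p q k
    using that by (auto simp: agree_of_tuples)
  show ?thesis
    unfolding game_all_coalitions_iff[OF CD[OF assms(1)] CD[OF assms(2)]]
    unfolding sim_of_def set_trans_of_names[OF assms(1)] set_trans_of_names[OF assms(2)] game_def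
      CD(2)[OF assms(1)] CD(2)[OF assms(2)]
    by (simp add: agree target_rel_def)
qed

lemma check_names:
  assumes "names (left z) C q" "names (right z) D r"
  shows "check d R z \<longleftrightarrow> label C q = label D r \<and>
    (\<forall>A\<subseteq>Ag. game A (target_rel R (left z) C (right z) D) C q D r) \<and>
    (\<forall>A\<subseteq>Ag. game A (target_rel R (right z) D (left z) C) D r C q)"
proof -
  have "label C q \<subseteq> set ps" if "names u C q" for u C q
    using cgs[OF namesD(1)[OF that]] namesD(2)[OF that] props[OF namesD(1)[OF that]]
    unfolding cgs_def by blast
  then show ?thesis
    unfolding check_def label_of_names[OF assms(1)] label_of_names[OF assms(2)]
      sim_of_names[OF assms] sim_of_names[OF assms(2,1)]
    using nums_eq_sublist assms by metis
qed

lemma tnth_structs: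
  assumes "num i < length Ms"
  shows "tnth (structs d) i = tree_of_cgs ps (qs (Ms ! num i)) (Ms ! num i)"
  using assms by (simp add: structs_d tnth_eq del: map_append)

lemma canonical_in_ids:
  assumes "names u C q"
  shows "Node (tree_of_nat (num (left u))) (tree_of_nat (num (right u))) \<in> set (list_of_tree (ids d))"
proof -
  let ?i = "tree_of_nat (num (left u))" and ?j = "tree_of_nat (num (right u))"
  have u: "num (left u) < length Ms" "num (right u) < length (qs (Ms ! num (left u)))"
    using assms unfolding names_def by blast+
  have "states_of (tnth (structs d) ?i) = tree_of_list (map (tree_of_state ps (qs (Ms ! num (left u)))
      (Ms ! num (left u))) (qs (Ms ! num (left u))))"
    using u(1) by (simp add: tnth_structs states_of_def tree_of_cgs_def)
  then have "?j \<in> set (list_of_tree (tupto (states_of (tnth (structs d) ?i))))"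
    using u(2) by (simp add: list_of_tree_tupto)
  moreover have "?i \<in> set (list_of_tree (tupto (structs d)))"
    using u(1) by (simp add: list_of_tree_tupto structs_d)
  ultimately show ?thesis unfolding ids_def by auto
qed

text \<open>Any two names can be replaced by the names made of leaves only, which are the ones
  listed in \<open>id_pairs d\<close>. This links list membership, preserved by refinement, with
  \<open>in_rel\<close>.\<close>

lemma in_rel_id_pairs:
  assumes "names u C q" "names v D r"
  obtains z where "z \<in> set (list_of_tree (id_pairs d))" "names (left z) C q" "names (right z) D r"
    "\<And>R. z \<in> set (list_of_tree R) \<Longrightarrow> in_rel R u v"
proof -
  define c where "c = (\<lambda>u. Node (tree_of_nat (num (left u))) (tree_of_nat (num (right u))))"
  have "Node (c u) (c v) \<in> set (list_of_tree (id_pairs d))"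
    using canonical_in_ids[OF assms(1)] canonical_in_ids[OF assms(2)]
    unfolding id_pairs_def c_def by auto
  moreover have "names (left (Node (c u) (c v))) C q" "names (right (Node (c u) (c v))) D r"
    using assms names_cong[of "c u" u] names_cong[of "c v" v] by (simp_all add: c_def)
  moreover have "in_rel R u v" if "Node (c u) (c v) \<in> set (list_of_tree R)" for R
    unfolding in_rel_def using that by (rule bexI[rotated]) (simp add: c_def)
  ultimately show thesis by (rule that)
qed

definition equivs :: "tree \<Rightarrow> bool" where
  "equivs z \<longleftrightarrow> (\<exists>C q D r. names (left z) C q \<and> names (right z) D r \<and> atl_equiv AP Ag C q D r)"

text \<open>The invariant of refinement: as long as a list contains all pairs of equivalent states,
  none of these pairs can fail the test, because equivalence is itself matched by
  \<open>game_atl_equiv\<close>.\<close>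

lemma check_if_equivs:
  assumes AP: "AP \<noteq> {}" and z: "equivs z"
    and R: "\<And>z. z \<in> set (list_of_tree (id_pairs d)) \<Longrightarrow> equivs z \<Longrightarrow> z \<in> set (list_of_tree R)"
  shows "check d R z"
proof -
  \<comment> \<open>Defining formulas are taken relative to all states of the whole sample.\<close>
  define U where "U = (SIGMA C:P \<union> N. states C)"
  have "finite (P \<union> N)" using sample unfolding sample_def by blast
  moreover have "finite (states C)" if "C \<in> P \<union> N" for C
    using cgs[OF that] unfolding cgs_def by blast
  ultimately have U: "finite U" unfolding U_def by (rule finite_SigmaI)
  have game: "game A (target_rel R u C v D) C q D r"
    if "A \<subseteq> Ag" and u: "names u C q" and v: "names v D r" and eq: "atl_equiv AP Ag C q D r"
    for A u C q v D r
  proof (rule game_mono)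
    note C = namesD[OF u] and D = namesD[OF v]
    show "cgs C" "q \<in> states C" "cgs D" "r \<in> states D" using cgs C D by blast+
    have "{C} \<times> states C \<subseteq> U" "{D} \<times> states D \<subseteq> U" using C(1) D(1) unfolding U_def by blast+
    then show "game A (\<lambda>u v. atl_equiv AP Ag C u D v) C q D r"
      using cgs agents C D eq \<open>A \<subseteq> Ag\<close> by (intro game_atl_equiv[OF U AP]) blast+
    fix q' r' assume q': "q' \<in> states C" and r': "r' \<in> states D" and eq': "atl_equiv AP Ag C q' D r'"
    obtain z where z: "z \<in> set (list_of_tree (id_pairs d))" "names (left z) C q'" "names (right z) D r'"
      "\<And>R. z \<in> set (list_of_tree R) \<Longrightarrow> in_rel R (Node (left u) (tree_of_nat (position (qs C) q')))
        (Node (left v) (tree_of_nat (position (qs D) r')))"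
      using in_rel_id_pairs[OF names_target[OF u q'] names_target[OF v r']] by blast
    then show "target_rel R u C v D q' r'"
      unfolding target_rel_def using R eq' unfolding equivs_def by blast
  qed
  obtain C q D r where n: "names (left z) C q" "names (right z) D r" and eq: "atl_equiv AP Ag C q D r"
    using z unfolding equivs_def by blast
  have eq': "atl_equiv AP Ag D r C q" using eq unfolding atl_equiv_def by simp
  have label: "label C q \<subseteq> AP" if "names u C q" for u C q
    using cgs[OF namesD(1)[OF that]] namesD(2)[OF that] props[OF namesD(1)[OF that]] ps
    unfolding cgs_def enumerates_def by blast
  have "label C q = label D r" using label_eq_if_atl_equiv[OF eq label[OF n(1)] label[OF n(2)]] .
  then show ?thesis
    unfolding check_names[OF n] using game[OF _ n eq] game[OF _ n(2,1) eq'] by blast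
qed

lemma equivs_in_equiv_rel:
  assumes "AP \<noteq> {}" "z \<in> set (list_of_tree (id_pairs d))" "equivs z"
  shows "z \<in> set (list_of_tree (equiv_rel d))"
proof -
  have "z \<in> set (list_of_tree (fold (\<lambda>_. refine d) us (id_pairs d)))"
    if "z \<in> set (list_of_tree (id_pairs d))" "equivs z" for z and us :: "tree list"
    using that
  proof (induction us arbitrary: z rule: rev_induct)
    case (snoc u us)
    then show ?case using check_if_equivs[OF assms(1) snoc.prems(2)] by (simp add: refine_def)
  qed simp
  then show ?thesis unfolding equiv_rel_def using assms(2,3) by blast
qed

text \<open>Equivalent pairs survive every round. Conversely, the final list is a fixed point of
  \<open>refine\<close>, so the pairs of states it names form an alternating bisimulation, and
  bisimilar states are equivalent.\<close>

lemma in_equiv_rel_iff: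
  assumes AP: "AP \<noteq> {}" and u: "names u C q" and v: "names v D r"
  shows "in_rel (equiv_rel d) u v \<longleftrightarrow> atl_equiv AP Ag C q D r"
proof
  assume eq: "atl_equiv AP Ag C q D r"
  obtain z where z: "z \<in> set (list_of_tree (id_pairs d))" "names (left z) C q" "names (right z) D r"
    "z \<in> set (list_of_tree (equiv_rel d)) \<Longrightarrow> in_rel (equiv_rel d) u v"
    using in_rel_id_pairs[OF u v] by blast
  then have "equivs z" using eq unfolding equivs_def by blast
  then show "in_rel (equiv_rel d) u v" using z(1,4) equivs_in_equiv_rel[OF AP] by blast
next
  assume uv: "in_rel (equiv_rel d) u v"
  define B0 where "B0 = (\<lambda>C q D r. \<exists>z\<in>set (list_of_tree (equiv_rel d)).
    names (left z) C q \<and> names (right z) D r)"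
  \<comment> \<open>The symmetric closure provides the symmetry required by
    \<open>alt_bisim\<close>; the game clause survives because \<open>check\<close> tests every pair
    in both directions.\<close>
  define B where "B = (\<lambda>C q D r. B0 C q D r \<or> B0 D r C q)"
  have B0: "B0 C q D r" if "names u C q" "names v D r" "in_rel (equiv_rel d) u v" for u v C q D r
  proof -
    obtain z where z: "z \<in> set (list_of_tree (equiv_rel d))"
      "num (left (left z)) = num (left u)" "num (right (left z)) = num (right u)"
      "num (left (right z)) = num (left v)" "num (right (right z)) = num (right v)"
      using \<open>in_rel (equiv_rel d) u v\<close> unfolding in_rel_def by blast
    then show ?thesis using that names_cong unfolding B0_def by blast
  qed
  have target: "game A (\<lambda>u v. B C u D v) C q D r"
    if "game A (target_rel (equiv_rel d) u C v D) C q D r" and u: "names u C q" and v: "names v D r"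
    for A u C q v D r
    using that(1)
  proof (rule game_mono)
    show "cgs C" "q \<in> states C" "cgs D" "r \<in> states D"
      using cgs namesD[OF u] namesD[OF v] by blast+
    fix q' r' assume "q' \<in> states C" "r' \<in> states D" "target_rel (equiv_rel d) u C v D q' r'"
    then show "B C q' D r'"
      unfolding target_rel_def B_def using B0[OF names_target[OF u] names_target[OF v]] by blast
  qed
  have bisim: "alt_bisim B Ag"
    unfolding alt_bisim_def
  proof (intro allI impI)
    fix C q D r
    assume B: "B C q D r"
    then obtain z where z: "z \<in> set (list_of_tree (equiv_rel d))"
      "names (left z) C q \<and> names (right z) D r \<or> names (left z) D r \<and> names (right z) C q"
      unfolding B_def B0_def by blast
    have check: "check d (equiv_rel d) z"
    proof -
      have "z \<in> set (list_of_tree (refine d (equiv_rel d)))" using z(1) refine_equiv_rel by simp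
      then show ?thesis by (simp add: refine_def)
    qed
    have "label C q = label D r \<and> (\<forall>A\<subseteq>Ag. game A (\<lambda>u v. B C u D v) C q D r)"
      using z(2)
    proof
      assume n: "names (left z) C q \<and> names (right z) D r"
      from check show ?thesis
        unfolding check_names[OF conjunct1[OF n] conjunct2[OF n]]
        using target[OF _ conjunct1[OF n] conjunct2[OF n]] by blast
    next
      assume n: "names (left z) D r \<and> names (right z) C q"
      from check have "label C q = label D r"
          "\<forall>A\<subseteq>Ag. game A (target_rel (equiv_rel d) (right z) C (left z) D) C q D r"
        unfolding check_names[OF conjunct1[OF n] conjunct2[OF n]] by simp_all
      then show ?thesis using target[OF _ conjunct2[OF n] conjunct1[OF n]] by blast
    qed
    moreover have "cgs C" "q \<in> states C" "agents C = Ag" using z(2) namesD cgs agents by blast+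
    moreover have "B D r C q" using B unfolding B_def by blast
    ultimately show "cgs C \<and> q \<in> states C \<and> agents C = Ag \<and> label C q = label D r \<and> B D r C q \<and>
        (\<forall>A\<subseteq>Ag. game A (\<lambda>u v. B C u D v) C q D r)" by blast
  qed
  have "B C q D r" using B0[OF u v uv] unfolding B_def by blast
  then show "atl_equiv AP Ag C q D r"
    unfolding atl_equiv_def using alt_bisim_sat(1)[OF bisim] by (intro allI impI)
qed

lemma inits_of_cgs:
  "C \<in> P \<union> N \<Longrightarrow> set (list_of_tree (inits_of (tree_of_cgs ps (qs C) C))) =
    (\<lambda>q. tree_of_nat (position (qs C) q)) ` inits C"
proof -
  assume C: "C \<in> P \<union> N"
  have "set (qs C) \<inter> inits C = inits C" using set_qs[OF C] cgs[OF C] unfolding cgs_def by blast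
  then show ?thesis by (simp add: inits_of_def tree_of_cgs_def set_list_of_tree_sublist)
qed

lemma ex_props_iff:
  "(\<exists>M\<in>set (list_of_tree (structs d)). left (right M) \<noteq> Leaf) \<longleftrightarrow> AP \<noteq> {}"
proof -
  have "tree_of_sublist ps (props C) \<noteq> Leaf \<longleftrightarrow> props C \<noteq> {}" if "C \<in> P \<union> N" for C
    using props[OF that] by (auto simp: tree_of_sublist_def filter_empty_conv)
  then have "(\<exists>C\<in>P \<union> N. tree_of_sublist ps (props C) \<noteq> Leaf) \<longleftrightarrow> AP \<noteq> {}"
    unfolding sample_props_def by auto
  then show ?thesis
    unfolding structs_d using set_Ms by (simp add: tree_of_cgs_def del: map_append set_append)
qed

lemma names_init:
  assumes "num i < length Ms" "q \<in> inits (Ms ! num i)"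
  shows "names (Node i (tree_of_nat (position (qs (Ms ! num i)) q))) (Ms ! num i) q"
proof -
  have C: "Ms ! num i \<in> P \<union> N" using assms(1) set_Ms nth_mem by blast
  then have "q \<in> set (qs (Ms ! num i))" using assms(2) cgs set_qs unfolding cgs_def by blast
  then show ?thesis using assms(1) by (simp add: names_def position_less nth_position)
qed

lemma solve_iff:
  "solve d \<longleftrightarrow> (\<exists>\<Phi>. atl_over AP Ag \<Phi> \<and> consistent \<Phi> (P, N))"
proof (cases "AP = {}")
  case True
  then show ?thesis unfolding ex_consistent_iff[OF sample] solve_def ex_props_iff by blast
next
  case False
  have N_i: "Ds ! i \<in> N" "Ds ! i \<in> P \<union> N" if "i < length Ds" for i
    using that Ds unfolding enumerates_def by auto
  have P_i: "Cs ! i \<in> P" "Cs ! i \<in> P \<union> N" if "i < length Cs" for i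
    using that Cs unfolding enumerates_def by auto
  have init_N: "set (list_of_tree (inits_of (tnth (right d) (tree_of_nat i)))) =
      (\<lambda>q. tree_of_nat (position (qs (Ds ! i)) q)) ` inits (Ds ! i)" if "i < length Ds" for i
    using that inits_of_cgs[OF N_i(2)[OF that]] by (simp add: d tnth_eq)
  have init_P: "set (list_of_tree (inits_of (tnth (left d) (tree_of_nat i)))) =
      (\<lambda>q. tree_of_nat (position (qs (Cs ! i)) q)) ` inits (Cs ! i)" if "i < length Cs" for i
    using that inits_of_cgs[OF P_i(2)[OF that]] by (simp add: d tnth_eq)
  have rel: "in_rel (equiv_rel d)
      (Node (tree_of_list (list_of_tree (left d) @ list_of_tree (tree_of_nat i)))
        (tree_of_nat (position (qs (Ds ! i)) q)))
      (Node (tree_of_nat j) (tree_of_nat (position (qs (Cs ! j)) r))) \<longleftrightarrow> atl_equiv AP Ag (Ds ! i) q (Cs ! j) r"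
    if "i < length Ds" "j < length Cs" "q \<in> inits (Ds ! i)" "r \<in> inits (Cs ! j)" for i j q r
  proof -
    let ?i = "tree_of_list (list_of_tree (left d) @ list_of_tree (tree_of_nat i))"
    have i: "num ?i = length Cs + i" by (simp add: d num_def tree_of_nat_def)
    then have Ms_i: "Ms ! num ?i = Ds ! i" by (simp add: nth_append)
    have Ms_j: "Ms ! num (tree_of_nat j) = Cs ! j" using that(2) by (simp add: nth_append)
    have "names (Node ?i (tree_of_nat (position (qs (Ds ! i)) q))) (Ds ! i) q"
      using names_init[of ?i q] that i Ms_i by simp
    moreover have "names (Node (tree_of_nat j) (tree_of_nat (position (qs (Cs ! j)) r))) (Cs ! j) r"
      using names_init[of "tree_of_nat j" r] that Ms_j by simp
    ultimately show ?thesis by (rule in_equiv_rel_iff[OF False])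
  qed
  have num_d: "num (right d) = length Ds" "num (left d) = length Cs" by (simp_all add: d)
  have "solve d \<longleftrightarrow> (\<forall>i<length Ds. \<exists>q\<in>inits (Ds ! i). \<forall>j<length Cs. \<forall>r\<in>inits (Cs ! j).
      \<not> atl_equiv AP Ag (Ds ! i) q (Cs ! j) r)"
    unfolding solve_def ex_props_iff ball_tupto num_d
    using False by (simp add: init_N init_P rel)
  also have "\<dots> \<longleftrightarrow> (\<forall>C\<in>set Ds. \<exists>q\<in>inits C. \<forall>D\<in>set Cs. \<forall>r\<in>inits D. \<not> atl_equiv AP Ag C q D r)"
    by (simp add: all_set_conv_all_nth)
  finally show ?thesis
    unfolding ex_consistent_iff[OF sample] using False Cs Ds by (simp add: enumerates_def)
qed

end


section \<open>Size of the encoding\<close>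

lemma card_act:
  "card (act C (agents C) q) = (\<Prod>a\<in>agents C. moves C q a)"
  by (simp add: act_def card_PiE agents_def)

lemma length_act_lists: "length (act_lists C q) = card (act C (agents C) q)"
proof -
  have "length (act_lists C q) = prod_list (map (moves C q) [1..<Suc (num_agents C)])"
    by (simp add: act_lists_def length_product_lists prod_list.eq_foldr comp_def del: upt_Suc)
  also have "\<dots> = prod (moves C q) (set [1..<Suc (num_agents C)])"
    by (rule prod.distinct_set_conv_list[symmetric]) simp
  also have "set [1..<Suc (num_agents C)] = agents C" by (auto simp: agents_def)
  finally show ?thesis by (simp add: card_act)
qed

context
  fixes C :: "('q, 'p) cgs"
  assumes C: "cgs C"
begin

lemma card_act_pos: "q \<in> states C \<Longrightarrow> card (act C (agents C) q) \<ge> 1"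
  using C unfolding card_act cgs_def by (fastforce intro: prod_ge_1)

lemma card_all_act: "card (all_act C) = (\<Sum>q\<in>states C. card (act C (agents C) q))"
proof -
  have "finite (act C (agents C) q)" for q unfolding act_def by (rule finite_PiE) (auto simp: agents_def)
  then show ?thesis using C unfolding all_act_def cgs_def by simp
qed

text \<open>The size of a structure counts action tuples instead of states, and each state
  contributes at least one tuple.\<close>

lemma card_states_le: "card (states C) \<le> cgs_size C"
  using sum_mono[of "states C" "\<lambda>_. 1" "\<lambda>q. card (act C (agents C) q)"] card_act_pos
  by (simp add: cgs_size_def card_all_act)

lemma card_act_le:
  assumes "q \<in> states C"
  shows "card (act C (agents C) q) \<le> cgs_size C"
proof -
  have "finite (states C)" using C by (simp add: cgs_def)
  then have "card (act C (agents C) q) \<le> card (all_act C)"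
    unfolding card_all_act using assms by (intro member_le_sum) auto
  then show ?thesis by (simp add: cgs_size_def)
qed

text \<open>The number of tuples at \<open>q\<close> is a product of positive numbers one of which
  is \<open>moves C q a\<close>. This bounds the unary action counts in the encoding.\<close>

lemma moves_le:
  assumes "q \<in> states C" "a \<in> agents C"
  shows "moves C q a \<le> cgs_size C"
proof -
  have "moves C q a dvd card (act C (agents C) q)"
    unfolding card_act using assms(2) by (intro dvd_prodI) (auto simp: agents_def)
  then have "moves C q a \<le> card (act C (agents C) q)"
    using card_act_pos[OF assms(1)] by (intro dvd_imp_le) auto
  then show ?thesis using card_act_le[OF assms(1)] by linarith
qed

end

section \<open>Polynomial bounds for the encoded trees\<close>

lemma size_sublist_le:
  assumes "length xs \<le> n"
  shows "size (tree_of_sublist xs A) \<le> n + n * n"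
  unfolding tree_of_sublist_def
proof (rule size_tree_of_list_le)
  show "length (map (\<lambda>x. tree_of_nat (position xs x)) (filter (\<lambda>x. x \<in> A) xs)) \<le> n"
    using assms order_trans[OF length_filter_le] by simp
  fix t assume "t \<in> set (map (\<lambda>x. tree_of_nat (position xs x)) (filter (\<lambda>x. x \<in> A) xs))"
  then show "size t \<le> n" using position_less assms by fastforce
qed

text \<open>A term \<open>n + n * m\<close> bounds a list of at most \<open>n\<close> trees of size
  at most \<open>m\<close>. The summands stand for the three cells of the outer list, the label, the
  action counts and the transition table.\<close>

lemma size_tree_of_state_le:
  assumes C: "cgs C" and q: "q \<in> states C" and n: "cgs_size C \<le> n"
    and ps: "length ps \<le> n" and qs: "length qs \<le> n"
  shows "size (tree_of_state ps qs C q) \<le> 3 + (n + n * n) + (n + n * n) + (n + n * (1 + (n + n * n) + n))"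
proof -
  have k: "num_agents C \<le> n" using n by (simp add: cgs_size_def agents_def)
  have upto: "set [1..<Suc (num_agents C)] = agents C" by (auto simp: agents_def)
  let ?L = "map (\<lambda>a. tree_of_nat (moves C q a)) [1..<Suc (num_agents C)]"
  have 1: "size (tree_of_list ?L) \<le> n + n * n"
  proof (rule size_tree_of_list_le)
    fix t assume "t \<in> set ?L"
    then obtain a where "a \<in> agents C" "t = tree_of_nat (moves C q a)"
      unfolding set_map upto by blast
    then show "size t \<le> n" using moves_le[OF C q] n le_trans by fastforce
  qed (use k in simp)
  let ?T = "map (\<lambda>\<alpha>s. Node (tree_of_list (map tree_of_nat \<alpha>s))
    (tree_of_nat (position qs (trans C q (act_of_list C \<alpha>s))))) (act_lists C q)"
  have 2: "size (tree_of_list ?T) \<le> n + n * (1 + (n + n * n) + n)"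
  proof (rule size_tree_of_list_le)
    show "length ?T \<le> n" using card_act_le[OF C q] n by (simp add: length_act_lists)
    fix t assume "t \<in> set ?T"
    then obtain \<alpha> where \<alpha>: "\<alpha> \<in> act C (agents C) q" and t: "t = Node
        (tree_of_list (map (\<lambda>a. tree_of_nat (\<alpha> a)) [1..<Suc (num_agents C)])) (tree_of_nat (position qs
        (trans C q (act_of_list C (map \<alpha> [1..<Suc (num_agents C)])))))"
      by (auto simp: set_act_lists comp_def simp del: upt_Suc)
    have "size (tree_of_list (map (\<lambda>a. tree_of_nat (\<alpha> a)) [1..<Suc (num_agents C)])) \<le> n + n * n"
    proof (rule size_tree_of_list_le)
      fix u assume "u \<in> set (map (\<lambda>a. tree_of_nat (\<alpha> a)) [1..<Suc (num_agents C)])"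
      then obtain a where a: "a \<in> agents C" "u = tree_of_nat (\<alpha> a)"
        unfolding set_map upto by blast
      then have "\<alpha> a \<le> moves C q a" using PiE_mem[OF \<alpha>[unfolded act_def]] by simp
      then show "size u \<le> n" using moves_le[OF C q a(1)] n a(2) by simp
    qed (use k in simp)
    moreover have "position qs x \<le> n" for x
      using qs length_takeWhile_le[of "\<lambda>y. y \<noteq> x" qs] unfolding position_def by linarith
    ultimately show "size t \<le> 1 + (n + n * n) + n" unfolding t by (simp add: add_mono)
  qed
  show ?thesis
    using 1 2 size_sublist_le[OF ps, of "label C q"] unfolding tree_of_state_def by simp
qed

lemma size_tree_of_cgs_le:
  assumes C: "cgs C" and n: "cgs_size C \<le> n" and ps: "length ps \<le> n"
    and qs: "length qs \<le> n" "set qs = states C"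
  shows "size (tree_of_cgs ps qs C) \<le> 4 + n + (n + n * n) + (n + n * n) +
    (n + n * (3 + (n + n * n) + (n + n * n) + (n + n * (1 + (n + n * n) + n))))"
proof -
  have "num_agents C \<le> n" using n by (simp add: cgs_size_def agents_def)
  moreover have "size (tree_of_list (map (tree_of_state ps qs C) qs)) \<le>
      n + n * (3 + (n + n * n) + (n + n * n) + (n + n * (1 + (n + n * n) + n)))"
    using size_tree_of_state_le[OF C _ n ps qs(1)] qs by (intro size_tree_of_list_le) auto
  ultimately show ?thesis
    using size_sublist_le[OF ps, of "props C"] size_sublist_le[OF qs(1), of "inits C"]
    unfolding tree_of_cgs_def by simp
qed

text \<open>A structure in both \<open>P\<close> and \<open>N\<close> is encoded twice but counted
  once in the sample size; therefore each half is bounded by the whole of \<open>n\<close>, which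
  gives the factor \<open>2\<close>.\<close>

lemma (in coded_sample) size_le:
  defines "n \<equiv> sample_size (P, N)"
  shows "size d \<le> 1 + 2 * (n + n * (4 + n + (n + n * n) + (n + n * n) +
    (n + n * (3 + (n + n * n) + (n + n * n) + (n + n * (1 + (n + n * n) + n))))))"
proof -
  have fin: "finite (P \<union> N)" using sample unfolding sample_def by blast
  have n: "n = (\<Sum>C\<in>P \<union> N. cgs_size C)" unfolding n_def sample_size_def by simp
  have size: "cgs_size C \<le> n" if "C \<in> P \<union> N" for C
    unfolding n using fin that by (intro member_le_sum) auto
  \<comment> \<open>Each structure has an agent, so the number of structures is at most
    \<open>n\<close>.\<close>
  have "1 \<le> cgs_size C" if "C \<in> P \<union> N" for C
    using cgs[OF that] unfolding cgs_def cgs_size_def agents_def by simp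
  then have "card (P \<union> N) \<le> n"
    unfolding n using sum_mono[of "P \<union> N" "\<lambda>_. 1" cgs_size] by simp
  then have "card P \<le> n" "card N \<le> n"
    using card_mono[OF fin, of P] card_mono[OF fin, of N] by auto
  then have len: "length Cs \<le> n" "length Ds \<le> n"
    using Cs Ds distinct_card unfolding enumerates_def by metis+
  have "length ps = card AP" using ps distinct_card unfolding enumerates_def by metis
  also have "\<dots> \<le> (\<Sum>C\<in>P \<union> N. card (props C))"
    unfolding sample_props_def prod.case using fin by (rule card_UN_le)
  also have "\<dots> \<le> n" unfolding n by (intro sum_mono) (simp add: cgs_size_def)
  finally have ps_n: "length ps \<le> n" .
  let ?c = "4 + n + (n + n * n) + (n + n * n) +
    (n + n * (3 + (n + n * n) + (n + n * n) + (n + n * (1 + (n + n * n) + n))))"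
  have c: "size (tree_of_cgs ps (qs C) C) \<le> ?c" if C: "C \<in> P \<union> N" for C
  proof (rule size_tree_of_cgs_le)
    have "length (qs C) = card (states C)" using qs[OF C] distinct_card unfolding enumerates_def by metis
    then show "length (qs C) \<le> n" using card_states_le[OF cgs[OF C]] size[OF C] by linarith
  qed (use cgs[OF C] size[OF C] ps_n set_qs[OF C] in auto)
  have "size (tree_of_list (map (\<lambda>C. tree_of_cgs ps (qs C) C) Es)) \<le> n + n * ?c"
    if "length Es \<le> n" "set Es \<subseteq> P \<union> N" for Es
    using that c by (intro size_tree_of_list_le) auto
  from this[OF len(1)] this[OF len(2)] show ?thesis
    using Cs Ds unfolding d enumerates_def by simp
qed

theorem theorem1:
  shows "poly_time_decidable (sample :: ('q, 'p) sample \<Rightarrow> bool) codes_sample sample_size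
    (\<lambda>S. \<exists>\<Phi>. atl_over (sample_props S) (sample_agents S) \<Phi> \<and> consistent \<Phi> S)"
proof -
  let ?f = "\<lambda>x. if solve x then Node Leaf Leaf else Leaf"
  have "ptime ?f" using ptest_solve by (simp add: ptest_def)
  then obtain b c where b: "pbound b" and c: "\<And>s. \<exists>t\<le>b (s 0). exec c s t (s(0 := ?f (s 0)))"
    unfolding ptime_def by blast
  obtain p where p: "\<And>x. b x \<le> poly p (size x)" using b unfolding pbound_def by blast
  define X :: "nat poly" where "X = [:0, 1:]"
  \<comment> \<open>The bound of \<open>size_le\<close> as a polynomial; composed with the time
    bound \<open>p\<close> in the tree size it yields a bound in the sample size.\<close>
  define B where "B = 1 + [:2:] * (X + X * ([:4:] + X + (X + X * X) + (X + X * X) +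
    (X + X * ([:3:] + (X + X * X) + (X + X * X) + (X + X * (1 + (X + X * X) + X))))))"
  have poly_B: "poly B n = 1 + 2 * (n + n * (4 + n + (n + n * n) + (n + n * n) +
    (n + n * (3 + (n + n * n) + (n + n * n) + (n + n * (1 + (n + n * n) + n))))))" for n
    by (simp add: B_def X_def algebra_simps)
  have "\<exists>t s. exec c (input d) t s \<and> t \<le> poly (pcompose p B) (sample_size S) \<and>
      (s 0 \<noteq> Leaf \<longleftrightarrow> (\<exists>\<Phi>. atl_over (sample_props S) (sample_agents S) \<Phi> \<and> consistent \<Phi> S))"
    if S: "sample S" and d: "codes_sample S d" for S :: "('q, 'p) sample" and d
  proof -
    obtain P N where PN: "S = (P, N)" by fastforce
    from d[unfolded PN codes_sample_def prod.case] obtain ps Cs Ds qs where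
      enc: "enumerates ps (sample_props (P, N))" "enumerates Cs P" "enumerates Ds N"
        "\<forall>C\<in>P \<union> N. enumerates (qs C) (states C)"
        "d = Node (tree_of_list (map (\<lambda>C. tree_of_cgs ps (qs C) C) Cs))
                  (tree_of_list (map (\<lambda>C. tree_of_cgs ps (qs C) C) Ds))"
      by blast
    interpret coded_sample P N ps Cs Ds qs d
      by (rule coded_sample.intro) (use S[unfolded PN] enc in blast)+
    obtain t where t: "t \<le> b d" "exec c (input d) t ((input d)(0 := ?f d))"
      using c[of "input d"] by (auto simp: input_def)
    have "b d \<le> poly p (poly B (sample_size S))"
      using p[of d] poly_nat_mono[OF size_le, of p] unfolding PN poly_B by linarith
    then have "t \<le> poly (pcompose p B) (sample_size S)"
      using t(1) by (simp add: poly_pcompose)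
    then show ?thesis using t(2) solve_iff unfolding PN by (intro exI conjI) auto
  qed
  then show ?thesis unfolding poly_time_decidable_def by blast
qed

end
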